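(* Let $\mathcal{M}$ be a von Neumann algebra with a faithful normal semifinite trace $\tau$, and let $d\ge 1$. Let $Z:L_1(\mathcal{M}_{sa},\tau)\to L_1(\mathcal{M}_{sa},\tau)$ be a unital positive contraction, and let $T_1,\dots,T_d:L_1(\mathcal{M}_{sa},\tau)\to L_1(\mathcal{M}_{sa},\tau)$ be unital positive contractions such that $ZT_i=T_iZ$ and $T_iT_j=T_jT_i$ for all $i,j\in\{1,\dots,d\}$. For $\mathbf{n}=(n_1,\dots,n_d)\in\mathbb{N}_0^d$ put $\mathbf{T}^{\mathbf{n}}:=T_1^{n_1}\cdots T_d^{n_d}$. Suppose there are $\mathbf{m}\in\mathbb{N}_0^d$, $\mathbf{k}\in\mathbb{N}_0^d$ and a positive contraction $S:L_1(\mathcal{M}_{sa},\tau)\to L_1(\mathcal{M}_{sa},\tau)$ with $SZ=ZS$ such that $$Z\mathbf{T}^{\mathbf{m}+\mathbf{k}}\ge ZS,\qquad Z\mathbf{T}^{\mathbf{m}}\ge ZS,$$ $$\|Z(\mathbf{T}^{\mathbf{m}+\mathbf{k}}-S)\|<1,\qquad \|Z(\mathbf{T}^{\mathbf{m}}-S)\|<1.$$ Then for every $\varepsilon>0$ there are $N\in\mathbb{N}$ and $\mathbf{n}_0\in\mathbb{N}_0^d$ such that $$\|Z^{N}(\mathbf{T}^{\mathbf{n}+\mathbf{k}}-\mathbf{T}^{\mathbf{n}})\|<\varepsilon\quad\text{for all }\mathbf{n}\ge\mathbf{n}_0.$$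
   Context: $\mathcal{M}_{sa}$ is the set of self-adjoint elements of $\mathcal{M}$. $L_1(\mathcal{M},\tau)$ is the completion of $\{x\in \mathcal{M}:\tau(|x|)<\infty\}$ in the norm $\|x\|_1=\tau(|x|)$, where $|x|=\sqrt{x^*x}$; it is isometrically identified with the predual of $\mathcal{M}$. $L_1(\mathcal{M}_{sa},\tau)$ is its real subspace of self-adjoint elements, a real Banach space whose dual is $\mathcal{M}_{sa}$ (via $\langle x,a\rangle=\tau(xa)$). Operators are real-linear maps on $L_1(\mathcal{M}_{sa},\tau)$. An operator $T$ is positive if $Tx\ge0$ whenever $x\ge 0$; it is a contraction if $\|Tx\|_1\le\|x\|_1$ for all $x$. The operator norm is $\|T\|=\sup\{\|Tx\|_1:\|x\|_1=1,\ x\in L_1(\mathcal{M}_{sa},\tau)\}$. For operators $A,B$, $A\le B$ (equivalently $B\ge A$) means that $B-A$ is positive. A positive contraction $T$ is called unital if its conjugate $T^*:\mathcal{M}_{sa}\to\mathcal{M}_{sa}$ satisfies $T^*\mathbf{1}=\mathbf{1}$, where $\mathbf 1$ is the unit of $\mathcal{M}$. $\mathbb{N}_0=\mathbb{N}\cup\{0\}$; addition on $\mathbb{N}_0^d$ is coordinatewise, and $\mathbf{n}\le\mathbf{k}$ means $n_i\le k_i$ for all $i$. *)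

theory Defs
  imports "HOL-Analysis.Analysis"
begin

class complex_normed_space = real_normed_vector +
  fixes scaleC :: "complex \<Rightarrow> 'a \<Rightarrow> 'a"  (infixr \<open>*\<^sub>C\<close> 75)
  assumes scaleC_add_right: "c *\<^sub>C (x + y) = c *\<^sub>C x + c *\<^sub>C y"
    and scaleC_add_left: "(b + c) *\<^sub>C x = b *\<^sub>C x + c *\<^sub>C x"
    and scaleC_scaleC: "b *\<^sub>C (c *\<^sub>C x) = (b * c) *\<^sub>C x"
    and scaleR_scaleC: "r *\<^sub>R x = complex_of_real r *\<^sub>C x"
    and norm_scaleC: "norm (c *\<^sub>C x) = cmod c * norm x"

class complex_banach = complex_normed_space + complete_space

subclass (in complex_banach) banach ..

class complex_hilbert = complex_banach +
  fixes cinner :: "'a \<Rightarrow> 'a \<Rightarrow> complex"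
  assumes cinner_add_right: "cinner x (y + z) = cinner x y + cinner x z"
    and cinner_scaleC_right: "cinner x (c *\<^sub>C y) = c * cinner x y"
    and cinner_commute: "cinner x y = cnj (cinner y x)"
    and norm_eq_sqrt_cinner: "norm x = sqrt (Re (cinner x x))"

lemma bounded_linear_scaleC: "bounded_linear (\<lambda>x :: 'a :: complex_normed_space. c *\<^sub>C x)"
proof (rule bounded_linear_intro[where K = "cmod c"])
  fix x y :: 'a and r :: real
  show "c *\<^sub>C (x + y) = c *\<^sub>C x + c *\<^sub>C y"
    by (rule scaleC_add_right)
  show "c *\<^sub>C (r *\<^sub>R x) = r *\<^sub>R (c *\<^sub>C x)"
    by (simp add: scaleR_scaleC scaleC_scaleC mult.commute)
  show "norm (c *\<^sub>C x) \<le> norm x * cmod c"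
    by (simp add: norm_scaleC)
qed

instantiation blinfun :: (real_normed_vector, complex_normed_space) complex_normed_space
begin

definition scaleC_blinfun :: "complex \<Rightarrow> ('a \<Rightarrow>\<^sub>L 'b) \<Rightarrow> ('a \<Rightarrow>\<^sub>L 'b)" where
  "scaleC_blinfun c A = Blinfun (\<lambda>x. c *\<^sub>C blinfun_apply A x)"

lemma scaleC_blinfun_apply: "blinfun_apply (c *\<^sub>C A) x = c *\<^sub>C blinfun_apply A x"
  for A :: "'a \<Rightarrow>\<^sub>L 'b"
  unfolding scaleC_blinfun_def
  by (subst bounded_linear_Blinfun_apply)
     (auto intro: bounded_linear_compose[OF bounded_linear_scaleC] blinfun.bounded_linear_right)

instance
proof
  fix b c :: complex and A B :: "'a \<Rightarrow>\<^sub>L 'b" and r :: real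
  show "c *\<^sub>C (A + B) = c *\<^sub>C A + c *\<^sub>C B"
    by (rule blinfun_eqI) (simp add: scaleC_blinfun_apply blinfun.add_left scaleC_add_right)
  show "(b + c) *\<^sub>C A = b *\<^sub>C A + c *\<^sub>C A"
    by (rule blinfun_eqI) (simp add: scaleC_blinfun_apply blinfun.add_left scaleC_add_left)
  show "b *\<^sub>C (c *\<^sub>C A) = (b * c) *\<^sub>C A"
    by (rule blinfun_eqI) (simp add: scaleC_blinfun_apply scaleC_scaleC)
  show "r *\<^sub>R A = complex_of_real r *\<^sub>C A"
    by (rule blinfun_eqI) (simp add: scaleC_blinfun_apply blinfun.scaleR_left scaleR_scaleC)
  have le: "norm (c *\<^sub>C A) \<le> cmod c * norm A" for c :: complex and A :: "'a \<Rightarrow>\<^sub>L 'b"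
  proof (rule norm_blinfun_bound)
    fix x
    have "norm (blinfun_apply (c *\<^sub>C A) x) = cmod c * norm (blinfun_apply A x)"
      by (simp add: scaleC_blinfun_apply norm_scaleC)
    also have "\<dots> \<le> cmod c * (norm A * norm x)"
      by (intro mult_left_mono norm_blinfun) auto
    finally show "norm (blinfun_apply (c *\<^sub>C A) x) \<le> cmod c * norm A * norm x"
      by (simp add: mult.assoc)
  qed simp
  show "norm (c *\<^sub>C A) = cmod c * norm A"
  proof (cases "c = 0")
    case True
    then show ?thesis using le[of 0 A] by simp
  next
    case False
    have one: "(1 :: complex) *\<^sub>C A = A"
      by (rule blinfun_eqI) (metis of_real_1 scaleC_blinfun_apply scaleR_one scaleR_scaleC)
    have "inverse c *\<^sub>C (c *\<^sub>C A) = (inverse c * c) *\<^sub>C A"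
      by (rule blinfun_eqI) (simp add: scaleC_blinfun_apply scaleC_scaleC)
    then have "norm A = norm (inverse c *\<^sub>C (c *\<^sub>C A))"
      using False one by simp
    also have "\<dots> \<le> cmod (inverse c) * norm (c *\<^sub>C A)" by (rule le)
    finally have "cmod c * norm A \<le> norm (c *\<^sub>C A)"
      using False by (simp add: norm_inverse norm_divide field_simps)
    with le[of c A] show ?thesis by simp
  qed
qed

end


text \<open>
  The library type of bounded operators is that of real-linear ones; \<open>B(H)\<close> is the subset of the
  complex-linear ones.
\<close>

definition bounded_ops :: "('h :: complex_hilbert \<Rightarrow>\<^sub>L 'h) set" where
  "bounded_ops = {A. \<forall>c x. blinfun_apply A (c *\<^sub>C x) = c *\<^sub>C blinfun_apply A x}"

definition is_adjoint :: "('h :: complex_hilbert \<Rightarrow>\<^sub>L 'h) \<Rightarrow> ('h \<Rightarrow>\<^sub>L 'h) \<Rightarrow> bool" where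
  "is_adjoint A B \<longleftrightarrow> (\<forall>x y. cinner (blinfun_apply A x) y = cinner x (blinfun_apply B y))"

definition adj :: "('h :: complex_hilbert \<Rightarrow>\<^sub>L 'h) \<Rightarrow> ('h \<Rightarrow>\<^sub>L 'h)" where
  "adj A = (THE B. is_adjoint A B)"

definition positive_op :: "('h :: complex_hilbert \<Rightarrow>\<^sub>L 'h) \<Rightarrow> bool" where
  "positive_op A \<longleftrightarrow> A \<in> bounded_ops \<and>
     (\<forall>x. cinner x (blinfun_apply A x) \<in> \<real> \<and> 0 \<le> Re (cinner x (blinfun_apply A x)))"

definition abs_op :: "('h :: complex_hilbert \<Rightarrow>\<^sub>L 'h) \<Rightarrow> ('h \<Rightarrow>\<^sub>L 'h)" where
  "abs_op A = (THE P. positive_op P \<and> P o\<^sub>L P = adj A o\<^sub>L A)"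

definition commutant :: "('h :: complex_hilbert \<Rightarrow>\<^sub>L 'h) set \<Rightarrow> ('h \<Rightarrow>\<^sub>L 'h) set" where
  "commutant M = {B \<in> bounded_ops. \<forall>A\<in>M. A o\<^sub>L B = B o\<^sub>L A}"

definition von_neumann_algebra :: "('h :: complex_hilbert \<Rightarrow>\<^sub>L 'h) set \<Rightarrow> bool" where
  "von_neumann_algebra M \<longleftrightarrow>
     M \<subseteq> bounded_ops \<and> (\<forall>A\<in>M. \<exists>B\<in>M. is_adjoint A B) \<and> commutant (commutant M) = M"

definition vn_pos :: "('h :: complex_hilbert \<Rightarrow>\<^sub>L 'h) set \<Rightarrow> ('h \<Rightarrow>\<^sub>L 'h) set" where
  "vn_pos M = {A \<in> M. positive_op A}"

definition vn_sa :: "('h :: complex_hilbert \<Rightarrow>\<^sub>L 'h) set \<Rightarrow> ('h \<Rightarrow>\<^sub>L 'h) set" where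
  "vn_sa M = {A \<in> M. adj A = A}"

definition op_le :: "('h :: complex_hilbert \<Rightarrow>\<^sub>L 'h) \<Rightarrow> ('h \<Rightarrow>\<^sub>L 'h) \<Rightarrow> bool" where
  "op_le A B \<longleftrightarrow> positive_op (B - A)"


text \<open>A trace is a weight \<open>M\<^sub>+ \<rightarrow> [0,\<infinity>]\<close>; its values outside \<open>vn_pos M\<close> are irrelevant.\<close>

definition trace_on :: "('h :: complex_hilbert \<Rightarrow>\<^sub>L 'h) set \<Rightarrow> (('h \<Rightarrow>\<^sub>L 'h) \<Rightarrow> ennreal) \<Rightarrow> bool" where
  "trace_on M \<tau> \<longleftrightarrow>
     (\<forall>x\<in>vn_pos M. \<forall>y\<in>vn_pos M. \<tau> (x + y) = \<tau> x + \<tau> y) \<and>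
     (\<forall>r\<ge>0. \<forall>x\<in>vn_pos M. \<tau> (r *\<^sub>R x) = ennreal r * \<tau> x) \<and>
     (\<forall>x\<in>M. \<tau> (adj x o\<^sub>L x) = \<tau> (x o\<^sub>L adj x))"

definition faithful_trace :: "('h :: complex_hilbert \<Rightarrow>\<^sub>L 'h) set \<Rightarrow> (('h \<Rightarrow>\<^sub>L 'h) \<Rightarrow> ennreal) \<Rightarrow> bool" where
  "faithful_trace M \<tau> \<longleftrightarrow> (\<forall>x\<in>vn_pos M. \<tau> x = 0 \<longrightarrow> x = 0)"

definition is_lub_in :: "('h :: complex_hilbert \<Rightarrow>\<^sub>L 'h) set \<Rightarrow> ('h \<Rightarrow>\<^sub>L 'h) set \<Rightarrow> ('h \<Rightarrow>\<^sub>L 'h) \<Rightarrow> bool" where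
  "is_lub_in M D s \<longleftrightarrow> s \<in> vn_sa M \<and> (\<forall>x\<in>D. op_le x s) \<and>
     (\<forall>u\<in>vn_sa M. (\<forall>x\<in>D. op_le x u) \<longrightarrow> op_le s u)"

definition normal_trace :: "('h :: complex_hilbert \<Rightarrow>\<^sub>L 'h) set \<Rightarrow> (('h \<Rightarrow>\<^sub>L 'h) \<Rightarrow> ennreal) \<Rightarrow> bool" where
  "normal_trace M \<tau> \<longleftrightarrow>
     (\<forall>D s. D \<noteq> {} \<and> D \<subseteq> vn_pos M \<and> (\<forall>x\<in>D. \<forall>y\<in>D. \<exists>z\<in>D. op_le x z \<and> op_le y z) \<and> is_lub_in M D s
        \<longrightarrow> \<tau> s = (SUP x\<in>D. \<tau> x))"

definition semifinite_trace :: "('h :: complex_hilbert \<Rightarrow>\<^sub>L 'h) set \<Rightarrow> (('h \<Rightarrow>\<^sub>L 'h) \<Rightarrow> ennreal) \<Rightarrow> bool" where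
  "semifinite_trace M \<tau> \<longleftrightarrow>
     (\<forall>x\<in>vn_pos M. x \<noteq> 0 \<longrightarrow> (\<exists>y\<in>vn_pos M. y \<noteq> 0 \<and> op_le y x \<and> \<tau> y < \<infinity>))"


definition trace_class :: "('h :: complex_hilbert \<Rightarrow>\<^sub>L 'h) set \<Rightarrow> (('h \<Rightarrow>\<^sub>L 'h) \<Rightarrow> ennreal) \<Rightarrow> ('h \<Rightarrow>\<^sub>L 'h) set" where
  "trace_class M \<tau> = {x \<in> M. \<tau> (abs_op x) < \<infinity>}"

text \<open>
  The linear extension of \<open>\<tau>\<close> to \<open>trace_class M \<tau>\<close>: on a self-adjoint \<open>x\<close> it is
  \<open>\<tau>(x\<^sub>+) - \<tau>(x\<^sub>-)\<close> with \<open>x\<^sub>\<plusminus> = (|x| \<plusminus> x)/2\<close>, and a general \<open>x\<close> is split as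
  \<open>(x + x\<^sup>*)/2 + i (x - x\<^sup>*)/(2i)\<close>.
\<close>

definition trace_ext_sa :: "(('h :: complex_hilbert \<Rightarrow>\<^sub>L 'h) \<Rightarrow> ennreal) \<Rightarrow> ('h \<Rightarrow>\<^sub>L 'h) \<Rightarrow> real" where
  "trace_ext_sa \<tau> x =
     enn2real (\<tau> ((1/2) *\<^sub>R (abs_op x + x))) - enn2real (\<tau> ((1/2) *\<^sub>R (abs_op x - x)))"

definition trace_ext :: "(('h :: complex_hilbert \<Rightarrow>\<^sub>L 'h) \<Rightarrow> ennreal) \<Rightarrow> ('h \<Rightarrow>\<^sub>L 'h) \<Rightarrow> complex" where
  "trace_ext \<tau> x =
     Complex (trace_ext_sa \<tau> ((1/2) *\<^sub>R (x + adj x)))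
             (trace_ext_sa \<tau> ((1 / (2 * \<i>)) *\<^sub>C (x - adj x)))"


text \<open>
  A completion of a complex normed space \<open>(V, nrm)\<close> is a Banach space with a linear isometry of
  \<open>V\<close> onto a dense subspace; it is unique up to isometric isomorphism. Only the values of the
  embedding on \<open>V\<close> matter.
\<close>

definition is_completion ::
  "'v :: complex_normed_space set \<Rightarrow> ('v \<Rightarrow> real) \<Rightarrow> ('v \<Rightarrow> 'l :: complex_banach) \<Rightarrow> bool" where
  "is_completion V nrm \<iota> \<longleftrightarrow>
     (0 \<in> V \<and> (\<forall>x\<in>V. \<forall>y\<in>V. x + y \<in> V) \<and> (\<forall>c. \<forall>x\<in>V. c *\<^sub>C x \<in> V)) \<and>
     (\<forall>x\<in>V. \<forall>y\<in>V. \<iota> (x + y) = \<iota> x + \<iota> y) \<and>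
     (\<forall>c. \<forall>x\<in>V. \<iota> (c *\<^sub>C x) = c *\<^sub>C \<iota> x) \<and>
     (\<forall>x\<in>V. norm (\<iota> x) = nrm x) \<and>
     closure (\<iota> ` V) = UNIV"

text \<open>
  \<open>\<iota>\<close> presents the type \<open>'l\<close> as \<open>L\<^sub>1(M,\<tau>)\<close>, with \<open>norm\<close> on \<open>'l\<close> as \<open>\<parallel>\<cdot>\<parallel>\<^sub>1\<close>.
\<close>

definition is_L1 ::
  "('h :: complex_hilbert \<Rightarrow>\<^sub>L 'h) set \<Rightarrow> (('h \<Rightarrow>\<^sub>L 'h) \<Rightarrow> ennreal) \<Rightarrow> (('h \<Rightarrow>\<^sub>L 'h) \<Rightarrow> 'l :: complex_banach) \<Rightarrow> bool" where
  "is_L1 M \<tau> \<iota> \<longleftrightarrow> is_completion (trace_class M \<tau>) (\<lambda>x. enn2real (\<tau> (abs_op x))) \<iota>"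

text \<open>
  The involution of \<open>L\<^sub>1(M,\<tau>)\<close> is the continuous extension of \<open>x \<mapsto> x\<^sup>*\<close>, given here by its graph:
  the closure of the graph over \<open>trace_class M \<tau>\<close>. (\<open>trace_class M \<tau>\<close> is closed under adjoints;
  membership of \<open>adj x\<close> is spelled out because \<open>\<iota>\<close> has meaning on that set only.)
\<close>

definition L1_adj ::
  "('h :: complex_hilbert \<Rightarrow>\<^sub>L 'h) set \<Rightarrow> (('h \<Rightarrow>\<^sub>L 'h) \<Rightarrow> ennreal) \<Rightarrow> (('h \<Rightarrow>\<^sub>L 'h) \<Rightarrow> 'l :: complex_banach)
     \<Rightarrow> 'l \<Rightarrow> 'l \<Rightarrow> bool" where
  "L1_adj M \<tau> \<iota> y z \<longleftrightarrow>
     (y, z) \<in> closure {(\<iota> x, \<iota> (adj x)) | x. x \<in> trace_class M \<tau> \<and> adj x \<in> trace_class M \<tau>}"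

definition L1_sa ::
  "('h :: complex_hilbert \<Rightarrow>\<^sub>L 'h) set \<Rightarrow> (('h \<Rightarrow>\<^sub>L 'h) \<Rightarrow> ennreal) \<Rightarrow> (('h \<Rightarrow>\<^sub>L 'h) \<Rightarrow> 'l :: complex_banach)
     \<Rightarrow> 'l set" where
  "L1_sa M \<tau> \<iota> = {y. L1_adj M \<tau> \<iota> y y}"

text \<open>The positive cone of \<open>L\<^sub>1\<close> is the closure of the positive elements of \<open>trace_class M \<tau>\<close>.\<close>

definition L1_pos ::
  "('h :: complex_hilbert \<Rightarrow>\<^sub>L 'h) set \<Rightarrow> (('h \<Rightarrow>\<^sub>L 'h) \<Rightarrow> ennreal) \<Rightarrow> (('h \<Rightarrow>\<^sub>L 'h) \<Rightarrow> 'l :: complex_banach)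
     \<Rightarrow> 'l set" where
  "L1_pos M \<tau> \<iota> = closure (\<iota> ` (trace_class M \<tau> \<inter> vn_pos M))"

text \<open>
  The pairing of \<open>L\<^sub>1(M\<^sub>s\<^sub>a,\<tau>)\<close> with \<open>M\<^sub>s\<^sub>a\<close>: the continuous extension in \<open>y\<close> of
  \<open>(x,a) \<mapsto> \<tau>(xa)\<close>.
\<close>

definition L1_pairing ::
  "('h :: complex_hilbert \<Rightarrow>\<^sub>L 'h) set \<Rightarrow> (('h \<Rightarrow>\<^sub>L 'h) \<Rightarrow> ennreal) \<Rightarrow> (('h \<Rightarrow>\<^sub>L 'h) \<Rightarrow> 'l :: complex_banach)
     \<Rightarrow> 'l \<Rightarrow> ('h \<Rightarrow>\<^sub>L 'h) \<Rightarrow> complex" where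
  "L1_pairing M \<tau> \<iota> y a =
     (THE c. \<forall>s. (\<forall>n. s n \<in> trace_class M \<tau> \<inter> vn_sa M) \<and> (\<lambda>n. \<iota> (s n)) \<longlonglongrightarrow> y
        \<longrightarrow> (\<lambda>n. trace_ext \<tau> (s n o\<^sub>L a)) \<longlonglongrightarrow> c)"


text \<open>
  In use \<open>X\<close> is \<open>L1_sa M \<tau> \<iota>\<close> and \<open>P\<close> is \<open>L1_pos M \<tau> \<iota>\<close>. An operator is a function on \<open>'l\<close> of
  which only the restriction to \<open>X\<close> matters.
\<close>

definition operator_on :: "'l :: real_normed_vector set \<Rightarrow> ('l \<Rightarrow> 'l) \<Rightarrow> bool" where
  "operator_on X T \<longleftrightarrow>
     (\<forall>x\<in>X. T x \<in> X) \<and>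
     (\<forall>x\<in>X. \<forall>y\<in>X. T (x + y) = T x + T y) \<and>
     (\<forall>r. \<forall>x\<in>X. T (r *\<^sub>R x) = r *\<^sub>R T x)"

definition positive_on :: "'l :: real_normed_vector set \<Rightarrow> ('l \<Rightarrow> 'l) \<Rightarrow> bool" where
  "positive_on P T \<longleftrightarrow> (\<forall>x\<in>P. T x \<in> P)"

definition le_on :: "'l :: real_normed_vector set \<Rightarrow> ('l \<Rightarrow> 'l) \<Rightarrow> ('l \<Rightarrow> 'l) \<Rightarrow> bool" where
  "le_on P A B \<longleftrightarrow> positive_on P (\<lambda>x. B x - A x)"

definition contraction_on :: "'l :: real_normed_vector set \<Rightarrow> ('l \<Rightarrow> 'l) \<Rightarrow> bool" where
  "contraction_on X T \<longleftrightarrow> (\<forall>x\<in>X. norm (T x) \<le> norm x)"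

definition commute_on :: "'l :: real_normed_vector set \<Rightarrow> ('l \<Rightarrow> 'l) \<Rightarrow> ('l \<Rightarrow> 'l) \<Rightarrow> bool" where
  "commute_on X A B \<longleftrightarrow> (\<forall>x\<in>X. A (B x) = B (A x))"

text \<open>In \<open>ennreal\<close> the supremum is \<open>\<infinity>\<close> for unbounded maps and \<open>0\<close> if \<open>X = {0}\<close>.\<close>

definition opnorm_on :: "'l :: real_normed_vector set \<Rightarrow> ('l \<Rightarrow> 'l) \<Rightarrow> ennreal" where
  "opnorm_on X T = (SUP x\<in>{x\<in>X. norm x = 1}. ennreal (norm (T x)))"

definition positive_contraction ::
  "('h :: complex_hilbert \<Rightarrow>\<^sub>L 'h) set \<Rightarrow> (('h \<Rightarrow>\<^sub>L 'h) \<Rightarrow> ennreal) \<Rightarrow> (('h \<Rightarrow>\<^sub>L 'h) \<Rightarrow> 'l :: complex_banach)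
     \<Rightarrow> ('l \<Rightarrow> 'l) \<Rightarrow> bool" where
  "positive_contraction M \<tau> \<iota> T \<longleftrightarrow>
     operator_on (L1_sa M \<tau> \<iota>) T \<and> positive_on (L1_pos M \<tau> \<iota>) T \<and> contraction_on (L1_sa M \<tau> \<iota>) T"

text \<open>
  The conjugate \<open>T\<^sup>*\<close>, as the relation \<open>T\<^sup>* a = b\<close> on \<open>M\<^sub>s\<^sub>a\<close>; it is the graph of a map because
  \<open>M\<^sub>s\<^sub>a\<close> is the dual of \<open>L\<^sub>1(M\<^sub>s\<^sub>a,\<tau>)\<close> under the pairing.
\<close>

definition is_conjugate ::
  "('h :: complex_hilbert \<Rightarrow>\<^sub>L 'h) set \<Rightarrow> (('h \<Rightarrow>\<^sub>L 'h) \<Rightarrow> ennreal) \<Rightarrow> (('h \<Rightarrow>\<^sub>L 'h) \<Rightarrow> 'l :: complex_banach)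
     \<Rightarrow> ('l \<Rightarrow> 'l) \<Rightarrow> ('h \<Rightarrow>\<^sub>L 'h) \<Rightarrow> ('h \<Rightarrow>\<^sub>L 'h) \<Rightarrow> bool" where
  "is_conjugate M \<tau> \<iota> T a b \<longleftrightarrow> a \<in> vn_sa M \<and> b \<in> vn_sa M \<and>
     (\<forall>y\<in>L1_sa M \<tau> \<iota>. L1_pairing M \<tau> \<iota> (T y) a = L1_pairing M \<tau> \<iota> y b)"

definition unital ::
  "('h :: complex_hilbert \<Rightarrow>\<^sub>L 'h) set \<Rightarrow> (('h \<Rightarrow>\<^sub>L 'h) \<Rightarrow> ennreal) \<Rightarrow> (('h \<Rightarrow>\<^sub>L 'h) \<Rightarrow> 'l :: complex_banach)
     \<Rightarrow> ('l \<Rightarrow> 'l) \<Rightarrow> bool" where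
  "unital M \<tau> \<iota> T \<longleftrightarrow> is_conjugate M \<tau> \<iota> T id_blinfun id_blinfun"

text \<open>\<open>T\<^sub>1\<^bsup>n\<^sub>1\<^esup> \<circ> \<dots> \<circ> T\<^sub>d\<^bsup>n\<^sub>d\<^esup>\<close>; multi-indices are functions of which only the values on \<open>{1..d}\<close> matter.\<close>

definition multi_pow :: "nat \<Rightarrow> (nat \<Rightarrow> 'l \<Rightarrow> 'l) \<Rightarrow> (nat \<Rightarrow> nat) \<Rightarrow> 'l \<Rightarrow> 'l" where
  "multi_pow d T n = foldr (\<lambda>i f. (T i ^^ n i) \<circ> f) [1..<Suc d] id"

end

theory Submission
  imports Defs
begin

text \<open>
  Let \<open>V = (1 + T\<^sup>k)/2\<close> and \<open>U = Z T\<^bsup>2m+k\<^esup>\<close>. Averaging the two decompositions of \<open>U\<close> provided by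
  the hypotheses gives \<open>U = V A + Q\<close> with \<open>A = T\<^sup>m Z S\<close> and \<open>Q\<close> positive and \<open>\<parallel>Q\<parallel> < 1\<close>. Since \<open>U\<close>
  commutes with \<open>V\<close>, iterating yields \<open>U\<^sup>N = V\<^sup>j B + R\<close> with \<open>B\<close>, \<open>R\<close> positive and \<open>\<parallel>R\<parallel>\<close> as small as we
  like, for every \<open>j\<close>. The norm of \<open>L\<^sub>1\<close> is additive on the positive cone and unital operators preserve it
  there, which forces \<open>\<parallel>B\<parallel> \<le> 1\<close>. As \<open>\<parallel>V\<^sup>j (T\<^sup>k - 1)\<parallel> \<le> 2 / sqrt (j + 1)\<close> by the variance of the binomial
  distribution, \<open>U\<^sup>N (T\<^sup>k - 1)\<close> is small in norm.

  Of the structure of \<open>L\<^sub>1(M\<^sub>s\<^sub>a,\<tau>)\<close> only the Jordan decomposition \<open>s = s\<^sub>+ - s\<^sub>-\<close> inside \<open>M\<close> enters; it rests on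
  the square root of \<open>s\<^sup>2\<close>, obtained in the bicommutant by a norm-convergent iteration.
\<close>

section \<open>Markov operators on a cone with additive norm\<close>

text \<open>The two order hypotheses enter with different multipliers: \<open>T^m\<close> applied to
  \<open>Z T^(m+k) >= Z S\<close> and \<open>T^(m+k)\<close> applied to \<open>Z T^m >= Z S\<close>
  bound the same operator \<open>U\<close> from below, once by \<open>A\<close> and once by
  \<open>T^k A\<close>. This is the source of the exponent \<open>2 m + k\<close> and of the average
  \<open>V\<close>. A single factor \<open>V\<close> gives no smallness; many are needed, because
  the gain comes from cancellation between adjacent binomial coefficients in
  \<open>V^j (T^k - 1)\<close>. Each extracted factor leaves a remainder, which is made small by a
  high power of \<open>Q\<close> before the next factor is extracted; the admissible errors are
  halved from round to round, so they do not accumulate. Since \<open>U^N\<close> contains exactly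
  \<open>Z^N\<close> and \<open>T^(N (2 m + k))\<close>, these give the power of \<open>Z\<close>
  and the threshold in the conclusion; further powers of \<open>T\<close> only contract.\<close>

locale cone_space =
  fixes X P :: "'l :: real_normed_vector set"
  assumes X_subspace: "subspace X"
    and P_sub: "P \<subseteq> X"
    and P_zero: "0 \<in> P"
    and P_add: "\<And>p q. p \<in> P \<Longrightarrow> q \<in> P \<Longrightarrow> p + q \<in> P"
    and P_scale: "\<And>r p. 0 \<le> r \<Longrightarrow> p \<in> P \<Longrightarrow> r *\<^sub>R p \<in> P"
    and norm_add_P: "\<And>p q. p \<in> P \<Longrightarrow> q \<in> P \<Longrightarrow> norm (p + q) = norm p + norm q"
    and decomposition: "\<And>x e. x \<in> X \<Longrightarrow> 0 < e \<Longrightarrow>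
      \<exists>p\<in>P. \<exists>q\<in>P. norm (x - (p - q)) \<le> e \<and> norm p + norm q \<le> norm x + e"
begin

lemma XI [intro, simp]: "x \<in> P \<Longrightarrow> x \<in> X"
  using P_sub by blast

lemma X_add [intro, simp]: "x \<in> X \<Longrightarrow> y \<in> X \<Longrightarrow> x + y \<in> X"
  and X_diff [intro, simp]: "x \<in> X \<Longrightarrow> y \<in> X \<Longrightarrow> x - y \<in> X"
  and X_scale [intro, simp]: "x \<in> X \<Longrightarrow> r *\<^sub>R x \<in> X"
  and X_zero [intro, simp]: "0 \<in> X"
  using X_subspace by (auto intro: subspace_add subspace_diff subspace_scale subspace_0)

lemma X_sum [intro]: "(\<And>i. i \<in> I \<Longrightarrow> g i \<in> X) \<Longrightarrow> sum g I \<in> X"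
  using X_subspace by (rule subspace_sum)

text \<open>The bound is left unspecified because the factors built during the iteration are sums
  and compositions; contractivity is recovered for them afterwards, from their values on the
  cone.\<close>

definition pos_operator :: "('l \<Rightarrow> 'l) \<Rightarrow> bool" where
  "pos_operator f \<longleftrightarrow> operator_on X f \<and> positive_on P f \<and> (\<exists>C. \<forall>x\<in>X. norm (f x) \<le> C * norm x)"

text \<open>Isometry on \<open>P\<close> is the form that unitality takes here: in
  \<open>L_1\<close> the pairing with the unit is the norm on positive elements.\<close>

definition markov :: "('l \<Rightarrow> 'l) \<Rightarrow> bool" where
  "markov f \<longleftrightarrow> operator_on X f \<and> positive_on P f \<and> contraction_on X f \<and> (\<forall>p\<in>P. norm (f p) = norm p)"

lemma operator_onD:
  assumes "operator_on X f"
  shows operator_mem [simp]: "x \<in> X \<Longrightarrow> f x \<in> X"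
    and operator_add: "x \<in> X \<Longrightarrow> y \<in> X \<Longrightarrow> f (x + y) = f x + f y"
    and operator_scale: "x \<in> X \<Longrightarrow> f (r *\<^sub>R x) = r *\<^sub>R f x"
    and operator_zero: "f 0 = 0"
    and operator_diff: "x \<in> X \<Longrightarrow> y \<in> X \<Longrightarrow> f (x - y) = f x - f y"
proof -
  show mem: "x \<in> X \<Longrightarrow> f x \<in> X" and add: "x \<in> X \<Longrightarrow> y \<in> X \<Longrightarrow> f (x + y) = f x + f y"
    and sc: "x \<in> X \<Longrightarrow> f (r *\<^sub>R x) = r *\<^sub>R f x" for x y r
    using assms unfolding operator_on_def by auto
  from sc[of 0 0] show "f 0 = 0" by simp
  show "x \<in> X \<Longrightarrow> y \<in> X \<Longrightarrow> f (x - y) = f x - f y"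
    using add[of x "(-1) *\<^sub>R y"] sc[of y "-1"] X_scale[of y "-1"] by simp
qed

lemma operator_sum:
  assumes f: "operator_on X f" and "\<And>i. i \<in> I \<Longrightarrow> g i \<in> X"
  shows "f (sum g I) = (\<Sum>i\<in>I. f (g i))"
  using assms(2)
  by (induction I rule: infinite_finite_induct)
     (auto simp: operator_zero[OF f] operator_add[OF f] X_sum)

lemma operator_on_id: "operator_on X id"
  by (auto simp: operator_on_def)

lemma operator_on_comp:
  assumes "operator_on X f" "operator_on X g"
  shows "operator_on X (f \<circ> g)"
  using assms by (auto simp: operator_on_def)

lemma operator_on_add:
  assumes "operator_on X f" "operator_on X g"
  shows "operator_on X (\<lambda>x. f x + g x)"
  using assms by (auto simp: operator_on_def scaleR_add_right)

lemma operator_on_diff: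
  assumes "operator_on X f" "operator_on X g"
  shows "operator_on X (\<lambda>x. f x - g x)"
  using assms by (auto simp: operator_on_def scaleR_diff_right)

lemma operator_on_scale:
  assumes "operator_on X f"
  shows "operator_on X (\<lambda>x. c *\<^sub>R f x)"
  using assms by (auto simp: operator_on_def scaleR_add_right)

lemma pos_operatorD:
  assumes "pos_operator f"
  shows "operator_on X f" and "p \<in> P \<Longrightarrow> f p \<in> P"
  using assms by (auto simp: pos_operator_def positive_on_def)

lemma pos_operatorE:
  assumes "pos_operator f"
  obtains C where "0 \<le> C" "\<And>x. x \<in> X \<Longrightarrow> norm (f x) \<le> C * norm x"
proof -
  obtain C where "\<forall>x\<in>X. norm (f x) \<le> C * norm x"
    using assms by (auto simp: pos_operator_def)
  then have "norm (f x) \<le> \<bar>C\<bar> * norm x" if "x \<in> X" for x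
    using that by (smt (verit) mult_right_mono norm_ge_zero)
  then show ?thesis using that[of "\<bar>C\<bar>"] by auto
qed

lemma pos_operatorI:
  assumes "operator_on X f" "\<And>p. p \<in> P \<Longrightarrow> f p \<in> P" "\<And>x. x \<in> X \<Longrightarrow> norm (f x) \<le> C * norm x"
  shows "pos_operator f"
  using assms unfolding pos_operator_def positive_on_def by blast

lemma markovD:
  assumes "markov f"
  shows "operator_on X f" and "p \<in> P \<Longrightarrow> f p \<in> P" and "x \<in> X \<Longrightarrow> norm (f x) \<le> norm x"
    and "p \<in> P \<Longrightarrow> norm (f p) = norm p" and "pos_operator f"
proof -
  show *: "operator_on X f" and **: "p \<in> P \<Longrightarrow> f p \<in> P" and ***: "x \<in> X \<Longrightarrow> norm (f x) \<le> norm x"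
    and "p \<in> P \<Longrightarrow> norm (f p) = norm p" for p x
    using assms by (auto simp: markov_def positive_on_def contraction_on_def)
  show "pos_operator f"
    by (rule pos_operatorI[of _ 1]) (use * ** *** in auto)
qed

lemma pos_operator_zero: "pos_operator (\<lambda>x. 0)"
  by (rule pos_operatorI[of _ 0]) (auto simp: operator_on_def P_zero)

lemma pos_operator_comp:
  assumes f: "pos_operator f" and g: "pos_operator g"
  shows "pos_operator (f \<circ> g)"
proof -
  obtain C where C: "0 \<le> C" "\<And>x. x \<in> X \<Longrightarrow> norm (f x) \<le> C * norm x"
    using pos_operatorE[OF f] by blast
  obtain D where D: "0 \<le> D" "\<And>x. x \<in> X \<Longrightarrow> norm (g x) \<le> D * norm x"
    using pos_operatorE[OF g] by blast
  show ?thesis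
  proof (rule pos_operatorI[where C = "C * D"])
    show "operator_on X (f \<circ> g)" using f g by (simp add: operator_on_comp pos_operatorD)
    show "p \<in> P \<Longrightarrow> (f \<circ> g) p \<in> P" for p using f g by (simp add: pos_operatorD)
    fix x assume x: "x \<in> X"
    then have "norm (f (g x)) \<le> C * norm (g x)"
      using C operator_mem[OF pos_operatorD(1)[OF g]] by blast
    also have "\<dots> \<le> C * (D * norm x)" using C D x by (intro mult_left_mono) auto
    finally show "norm ((f \<circ> g) x) \<le> C * D * norm x" by (simp add: mult.assoc)
  qed
qed

lemma pos_operator_add:
  assumes f: "pos_operator f" and g: "pos_operator g"
  shows "pos_operator (\<lambda>x. f x + g x)"
proof -
  obtain C where C: "0 \<le> C" "\<And>x. x \<in> X \<Longrightarrow> norm (f x) \<le> C * norm x"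
    using pos_operatorE[OF f] by blast
  obtain D where D: "0 \<le> D" "\<And>x. x \<in> X \<Longrightarrow> norm (g x) \<le> D * norm x"
    using pos_operatorE[OF g] by blast
  show ?thesis
  proof (rule pos_operatorI[where C = "C + D"])
    show "operator_on X (\<lambda>x. f x + g x)" using f g by (simp add: operator_on_add pos_operatorD)
    show "p \<in> P \<Longrightarrow> f p + g p \<in> P" for p using f g by (simp add: pos_operatorD P_add)
    fix x assume x: "x \<in> X"
    then show "norm (f x + g x) \<le> (C + D) * norm x"
      using C(2)[OF x] D(2)[OF x] norm_triangle_ineq[of "f x" "g x"] by (simp add: algebra_simps)
  qed
qed

lemma pos_operator_scale:
  assumes f: "pos_operator f" and c: "0 \<le> c"
  shows "pos_operator (\<lambda>x. c *\<^sub>R f x)"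
proof -
  obtain C where C: "0 \<le> C" "\<And>x. x \<in> X \<Longrightarrow> norm (f x) \<le> C * norm x"
    using pos_operatorE[OF f] by blast
  show ?thesis
    by (rule pos_operatorI[where C = "c * C"])
       (use f c C in \<open>auto simp: operator_on_scale pos_operatorD P_scale mult.assoc intro!: mult_left_mono\<close>)
qed

lemma markov_id: "markov id"
  by (simp add: markov_def operator_on_id positive_on_def contraction_on_def)

lemma markov_comp:
  assumes f: "markov f" and g: "markov g"
  shows "markov (f \<circ> g)"
proof -
  have "norm (f (g x)) \<le> norm x" if "x \<in> X" for x
    using markovD(3)[OF f, of "g x"] markovD(3)[OF g that] operator_mem[OF markovD(1)[OF g] that] by simp
  then show ?thesis
    using f g by (auto simp: markov_def operator_on_comp positive_on_def contraction_on_def)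
qed

lemma markov_funpow: "markov f \<Longrightarrow> markov (f ^^ n)"
  by (induction n) (auto simp: markov_id[unfolded id_def] id_def[symmetric] markov_id intro: markov_comp)

text \<open>Additivity of the norm on the cone is what keeps the average isometric there.\<close>

lemma markov_average:
  assumes W: "markov W"
  shows "markov (\<lambda>x. (1/2) *\<^sub>R (x + W x))"
  unfolding markov_def positive_on_def contraction_on_def
proof (intro conjI ballI)
  show "operator_on X (\<lambda>x. (1/2) *\<^sub>R (x + W x))"
    using operator_on_scale[OF operator_on_add[OF operator_on_id markovD(1)[OF W]]] by simp
  show "(1/2) *\<^sub>R (p + W p) \<in> P" if "p \<in> P" for p
    using that markovD(2)[OF W] by (intro P_scale P_add) auto
  show "norm ((1/2) *\<^sub>R (x + W x)) \<le> norm x" if "x \<in> X" for x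
    using norm_triangle_ineq[of x "W x"] markovD(3)[OF W that] by simp
  show "norm ((1/2) *\<^sub>R (p + W p)) = norm p" if "p \<in> P" for p
    using that markovD(2,4)[OF W that] by (simp add: norm_add_P)
qed

lemma commute_on_funpow:
  assumes "commute_on X f g" "operator_on X f" "operator_on X g"
  shows "commute_on X (f ^^ n) g"
proof -
  have "(f ^^ n) x \<in> X \<and> (f ^^ n) (g x) = g ((f ^^ n) x)" if "x \<in> X" for x
    using that assms by (induction n) (auto simp: commute_on_def operator_on_def)
  then show ?thesis by (simp add: commute_on_def)
qed

lemma commute_on_sym: "commute_on X f g \<Longrightarrow> commute_on X g f"
  by (simp add: commute_on_def)

text \<open>The decomposition supplies positive \<open>p\<close>, \<open>q\<close> with
  \<open>p - q\<close> close to \<open>x\<close> and total norm close to \<open>norm x\<close>, so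
  passing from the cone to \<open>X\<close> costs no factor 2. The a priori constant
  \<open>C\<close> only multiplies the approximation error and disappears in the limit.\<close>

lemma norm_le_from_cone:
  assumes f: "pos_operator f" and c: "0 \<le> c" and le: "\<And>p. p \<in> P \<Longrightarrow> norm (f p) \<le> c * norm p"
    and x: "x \<in> X"
  shows "norm (f x) \<le> c * norm x"
proof (rule field_le_epsilon)
  fix e :: real assume e: "0 < e"
  obtain C where C: "0 \<le> C" "\<And>x. x \<in> X \<Longrightarrow> norm (f x) \<le> C * norm x"
    using pos_operatorE[OF f] by blast
  \<comment> \<open>The accumulated error is \<open>(C + c) * \<delta>\<close>; the summand 1 keeps
    the denominator positive.\<close>
  define \<delta> where "\<delta> = e / (C + c + 1)"
  have pos: "0 < C + c + 1" using C c by simp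
  then have \<delta>: "0 < \<delta>" using e by (simp add: \<delta>_def)
  obtain p q where pq: "p \<in> P" "q \<in> P" "norm (x - (p - q)) \<le> \<delta>" "norm p + norm q \<le> norm x + \<delta>"
    using decomposition[OF x \<delta>] by blast
  note lin = pos_operatorD(1)[OF f]
  have eq: "f x = f (x - (p - q)) + f p - f q"
    using pq x by (simp add: operator_diff[OF lin])
  have "norm (f x) \<le> norm (f (x - (p - q))) + norm (f p) + norm (f q)"
    unfolding eq by (meson add_mono norm_triangle_ineq norm_triangle_ineq4 order_refl order_trans)
  also have "\<dots> \<le> C * \<delta> + c * norm p + c * norm q"
  proof -
    have "norm (f (x - (p - q))) \<le> C * norm (x - (p - q))" using pq x by (intro C(2)) simp
    also have "\<dots> \<le> C * \<delta>" using pq C by (intro mult_left_mono) auto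
    finally show ?thesis using le[OF pq(1)] le[OF pq(2)] by linarith
  qed
  also have "\<dots> \<le> C * \<delta> + c * (norm x + \<delta>)"
    using mult_left_mono[OF pq(4) c] by (simp add: algebra_simps)
  also have "\<dots> = c * norm x + (C + c) * \<delta>" by (simp add: algebra_simps)
  also have "\<dots> \<le> c * norm x + (C + c + 1) * \<delta>" using \<delta> by (simp add: algebra_simps)
  also have "\<dots> = c * norm x + e" using pos by (simp add: \<delta>_def)
  finally show "norm (f x) \<le> c * norm x + e" .
qed

end

section \<open>Cancellation in binomial averages\<close>

text \<open>Up to the factor \<open>4 * 2 ^ n\<close> this is the variance \<open>n / 4\<close> of a
  fair binomial law; the moments are those of the Bernstein polynomials at
  \<open>1/2\<close>.\<close>

lemma binomial_deviation:
  "(\<Sum>i\<le>n. real (n choose i) * (2 * real i - real n)\<^sup>2) = real n * 2 ^ n"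
proof -
  have B: "Bernstein n i (1/2) = real (n choose i) / 2 ^ n" if "i \<le> n" for i
    using that by (simp add: Bernstein_def power_one_over flip: power_add)
  have "(\<Sum>i\<le>n. real (n choose i) * (2 * real i - real n)\<^sup>2)
      = 2 ^ n * (\<Sum>i\<le>n. Bernstein n i (1/2) * (2 * real i - real n)\<^sup>2)"
    unfolding sum_distrib_left by (rule sum.cong) (simp_all add: B)
  also have "(\<Sum>i\<le>n. Bernstein n i (1/2) * (2 * real i - real n)\<^sup>2)
      = (\<Sum>i\<le>n. 4 * (real i * (real i - 1) * Bernstein n i (1/2))
          + (4 - 4 * real n) * (real i * Bernstein n i (1/2)) + (real n)\<^sup>2 * Bernstein n i (1/2))"
    by (rule sum.cong) (simp_all add: power2_eq_square algebra_simps)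
  also have "\<dots> = 4 * (real n * (real n - 1) * (1/2)\<^sup>2) + (4 - 4 * real n) * (real n * (1/2)) + (real n)\<^sup>2"
    by (simp add: sum.distrib sum_distrib_left[symmetric] sum_kk_Bernstein sum_k_Bernstein sum_Bernstein)
  also have "\<dots> = real n" by (simp add: power2_eq_square algebra_simps)
  finally show ?thesis by simp
qed

text \<open>In place of the Cauchy-Schwarz inequality, \<open>2 * r * |t| <= t^2 + r^2\<close> is
  applied termwise; for \<open>r = sqrt n\<close> the two resulting sums contribute equally.\<close>

lemma sum_abs_binomial_deviation:
  assumes "n > 0"
  shows "(\<Sum>i\<le>n. real (n choose i) * \<bar>2 * real i - real n\<bar>) \<le> sqrt (real n) * 2 ^ n"
proof -
  define r where "r = sqrt (real n)"
  have r: "r > 0" "r\<^sup>2 = real n" using assms by (auto simp: r_def)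
  have "\<bar>t\<bar> \<le> (t\<^sup>2 / r + r) / 2" for t :: real
  proof -
    have "0 \<le> (\<bar>t\<bar> - r)\<^sup>2" by simp
    then have "2 * r * \<bar>t\<bar> \<le> t\<^sup>2 + r\<^sup>2" by (simp add: power2_eq_square algebra_simps)
    then show ?thesis using r(1) by (simp add: field_simps power2_eq_square)
  qed
  then have "(\<Sum>i\<le>n. real (n choose i) * \<bar>2 * real i - real n\<bar>)
     \<le> (\<Sum>i\<le>n. real (n choose i) * (((2 * real i - real n)\<^sup>2 / r + r) / 2))"
    by (intro sum_mono mult_left_mono) auto
  also have "\<dots> = (\<Sum>i\<le>n. real (n choose i) * (2 * real i - real n)\<^sup>2) / (2 * r)
        + (r / 2) * (\<Sum>i\<le>n. real (n choose i))"
    unfolding sum_divide_distrib sum_distrib_left sum.distrib[symmetric]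
    by (rule sum.cong) (simp_all add: field_simps)
  also have "(\<Sum>i\<le>n. real (n choose i)) = 2 ^ n"
    using choose_row_sum[of n] by (metis of_nat_sum of_nat_numeral of_nat_power)
  also have "(\<Sum>i\<le>n. real (n choose i) * (2 * real i - real n)\<^sup>2) / (2 * r) + (r / 2) * 2 ^ n
      = r * 2 ^ n"
    unfolding binomial_deviation using r(1) by (simp add: field_simps power2_eq_square flip: r(2))
  finally show ?thesis by (simp add: r_def)
qed

context cone_space
begin

lemma average_power_expansion:
  assumes W: "operator_on X W" and x: "x \<in> X"
  shows "((\<lambda>x. (1/2) *\<^sub>R (x + W x)) ^^ j) x = (\<Sum>i\<le>j. (real (j choose i) / 2 ^ j) *\<^sub>R (W ^^ i) x)"
proof (induction j)
  case 0
  then show ?case by simp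
next
  case (Suc j)
  have mem: "(W ^^ i) x \<in> X" for i
    by (induction i) (use x operator_mem[OF W] in auto)
  define a where "a i = real (j choose i) / 2 ^ j" for i
  let ?s = "\<Sum>i\<le>j. a i *\<^sub>R (W ^^ i) x"
  have s: "?s = a 0 *\<^sub>R x + (\<Sum>i\<le>j. a (Suc i) *\<^sub>R (W ^^ Suc i) x)"
  proof -
    \<comment> \<open>The sum is lengthened by the index \<open>Suc j\<close>, where the binomial
      coefficient is 0, so that it can be shifted.\<close>
    have "?s = (\<Sum>i\<le>Suc j. a i *\<^sub>R (W ^^ i) x)" by (simp add: a_def)
    then show ?thesis by (simp only: sum.atMost_Suc_shift) simp
  qed
  have Ws: "W ?s = (\<Sum>i\<le>j. a i *\<^sub>R (W ^^ Suc i) x)"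
    using mem by (simp add: operator_sum[OF W] operator_scale[OF W])
  have "((\<lambda>x. (1/2) *\<^sub>R (x + W x)) ^^ Suc j) x = (1/2) *\<^sub>R (?s + W ?s)"
    using Suc by (simp add: a_def)
  also have "\<dots> = (1/2) *\<^sub>R (a 0 *\<^sub>R x + (\<Sum>i\<le>j. (a (Suc i) + a i) *\<^sub>R (W ^^ Suc i) x))"
    unfolding Ws by (subst s) (simp add: sum.distrib scaleR_add_left add.assoc)
  \<comment> \<open>Pascal's rule merges the two coefficients.\<close>
  also have "\<dots> = (1 / 2 ^ Suc j) *\<^sub>R x + (\<Sum>i\<le>j. (real (Suc j choose Suc i) / 2 ^ Suc j) *\<^sub>R (W ^^ Suc i) x)"
    by (simp add: scaleR_add_right scaleR_sum_right a_def add_divide_distrib add.commute mult.commute)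
  also have "\<dots> = (\<Sum>i\<le>Suc j. (real (Suc j choose i) / 2 ^ Suc j) *\<^sub>R (W ^^ i) x)"
    by (simp only: sum.atMost_Suc_shift) simp
  finally show ?case .
qed

text \<open>With \<open>n = j + 1\<close>, both terms are expanded in the coefficients
  \<open>n choose i\<close>; in the difference these carry the weight
  \<open>(2 * i - n) / n\<close>, which is small on the bulk of the binomial law. As the powers of
  \<open>W\<close> are contractions, the mean absolute deviation bounds the norm.\<close>

lemma average_power_difference:
  assumes W: "markov W" and x: "x \<in> X"
  shows "norm (((\<lambda>x. (1/2) *\<^sub>R (x + W x)) ^^ j) (W x - x)) \<le> 2 / sqrt (Suc j) * norm x"
proof -
  let ?V = "\<lambda>x. (1/2) *\<^sub>R (x + W x)"
  note op = markovD(1)[OF W]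
  define n where "n = Suc j"
  have n: "n > 0" by (simp add: n_def)
  have Wx: "W x \<in> X" using x operator_mem[OF op] by simp
  have opV: "operator_on X (?V ^^ j)" using markovD(1)[OF markov_funpow[OF markov_average[OF W]]] .
  have pow_le: "norm ((W ^^ i) x) \<le> norm x" for i
    using markovD(3)[OF markov_funpow[OF W] x] .
  \<comment> \<open>The coefficient is \<open>j choose (i - 1)\<close> expressed through
    \<open>n choose i\<close>: applying \<open>W\<close> moved the indices up by one, and the factor
    \<open>i\<close> removes the term at 0.\<close>
  have up: "(?V ^^ j) (W x) = (\<Sum>i\<le>n. (real (n choose i) * real i / (real n * 2 ^ j)) *\<^sub>R (W ^^ i) x)"
  proof -
    have c: "real (n choose Suc i) * real (Suc i) / (real n * 2 ^ j) = real (j choose i) / 2 ^ j" for i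
    proof -
      have "real (n choose Suc i) * real (Suc i) = real n * real (j choose i)"
        unfolding n_def using Suc_times_binomial[of i j] by (metis mult.commute of_nat_mult)
      then show ?thesis using n by simp
    qed
    have "(?V ^^ j) (W x) = (\<Sum>i\<le>j. (real (j choose i) / 2 ^ j) *\<^sub>R (W ^^ Suc i) x)"
      unfolding average_power_expansion[OF op Wx] by (simp add: funpow_swap1)
    also have "\<dots> = (\<Sum>i\<le>Suc j. (real (n choose i) * real i / (real n * 2 ^ j)) *\<^sub>R (W ^^ i) x)"
      by (simp only: sum.atMost_Suc_shift c) simp
    finally show ?thesis by (simp only: n_def)
  qed
  \<comment> \<open>The factor \<open>n - i\<close> vanishes at \<open>i = n\<close>, so this sum
    may have the same range as the shifted one.\<close>
  have down: "(?V ^^ j) x = (\<Sum>i\<le>n. (real (n choose i) * (real n - real i) / (real n * 2 ^ j)) *\<^sub>R (W ^^ i) x)"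
  proof -
    have c: "real (n choose i) * (real n - real i) / (real n * 2 ^ j) = real (j choose i) / 2 ^ j" if "i \<le> n" for i
    proof -
      have "real (n - i) * real (n choose i) = real n * real (j choose i)"
        using binomial_absorb_comp[of n i] by (metis n_def diff_Suc_1 of_nat_mult)
      then have "real (n choose i) * (real n - real i) = real n * real (j choose i)"
        using that by (simp add: of_nat_diff mult.commute)
      then show ?thesis using n by simp
    qed
    have "(?V ^^ j) x = (\<Sum>i\<le>n. (real (j choose i) / 2 ^ j) *\<^sub>R (W ^^ i) x)"
      by (simp add: average_power_expansion[OF op x] n_def)
    then show ?thesis using c by simp
  qed
  have "(?V ^^ j) (W x - x) = (?V ^^ j) (W x) - (?V ^^ j) x"
    by (rule operator_diff[OF opV Wx x])
  also have "\<dots> = (\<Sum>i\<le>n. (real (n choose i) * (2 * real i - real n) / (real n * 2 ^ j)) *\<^sub>R (W ^^ i) x)"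
    unfolding up down sum_subtractf[symmetric] scaleR_diff_left[symmetric]
    by (rule sum.cong) (simp_all add: diff_divide_distrib[symmetric] right_diff_distrib[symmetric])
  also have "norm \<dots> \<le> (\<Sum>i\<le>n. (real (n choose i) * \<bar>2 * real i - real n\<bar> / (real n * 2 ^ j)) * norm x)"
    by (rule sum_norm_le) (auto simp: abs_mult intro!: mult_mono divide_right_mono pow_le)
  also have "\<dots> = (\<Sum>i\<le>n. real (n choose i) * \<bar>2 * real i - real n\<bar>) / (real n * 2 ^ j) * norm x"
    by (simp add: sum_distrib_right sum_divide_distrib)
  also have "\<dots> \<le> (sqrt (real n) * 2 ^ n) / (real n * 2 ^ j) * norm x"
    by (intro mult_right_mono divide_right_mono sum_abs_binomial_deviation n) auto
  also have "(sqrt (real n) * 2 ^ n) / (real n * 2 ^ j) = 2 / sqrt (real n)"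
  proof -
    have "real n = sqrt (real n) * sqrt (real n)" by simp
    then show ?thesis using n by (simp add: n_def field_simps del: of_nat_Suc)
  qed
  finally show ?thesis by (simp add: n_def)
qed

section \<open>Repeated extraction of the average\<close>

text \<open>The name is that of the dichotomy in ergodic theory by which such differences either
  keep norm 2 or tend to 0. Commutation links only \<open>U\<close> and \<open>W\<close>, so powers
  of \<open>U\<close> are moved past \<open>V\<close> while \<open>A\<close> and \<open>Q\<close>
  stay on the right.\<close>

lemma zero_two_law:
  assumes U: "markov U" and W: "markov W" and comm: "commute_on X U W"
    and A: "pos_operator A" and Q: "pos_operator Q"
    and split: "\<And>x. x \<in> X \<Longrightarrow> U x = (1/2) *\<^sub>R (A x + W (A x)) + Q x"
    and lam: "0 \<le> q" "q < 1" and Q_le: "\<And>x. x \<in> X \<Longrightarrow> norm (Q x) \<le> q * norm x"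
    and e: "0 < e"
  shows "\<exists>N\<ge>1. \<forall>x\<in>X. norm ((U ^^ N) (W x - x)) \<le> e * norm x"
proof -
  define V where "V x = (1/2) *\<^sub>R (x + W x)" for x
  have V: "markov V" using markov_average[OF W] by (simp add: V_def[abs_def])
  note opU = markovD(1)[OF U] and opW = markovD(1)[OF W] and opV = markovD(1)[OF V]
    and opA = pos_operatorD(1)[OF A] and opQ = pos_operatorD(1)[OF Q]
  have Un: "markov (U ^^ n)" and Vn: "markov (V ^^ n)" for n using U V by (simp_all add: markov_funpow)
  have memU: "(U ^^ n) x \<in> X" and memV: "(V ^^ n) x \<in> X" if "x \<in> X" for n x
    using that operator_mem[OF markovD(1)[OF Un]] operator_mem[OF markovD(1)[OF Vn]] by auto
  have UV: "commute_on X U V"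
    using comm operator_mem[OF opW]
    by (simp add: commute_on_def V_def operator_scale[OF opU] operator_add[OF opU])
  have UnV: "(U ^^ n) (V x) = V ((U ^^ n) x)" if "x \<in> X" for n x
    using commute_on_funpow[OF UV opU opV] that by (simp add: commute_on_def)
  have UnVj: "(U ^^ n) ((V ^^ j) x) = (V ^^ j) ((U ^^ n) x)" if "x \<in> X" for n j x
  proof (induction j)
    case (Suc j)
    then show ?case using UnV[OF memV[OF that]] by simp
  qed simp
  have Qn_le: "(Q ^^ n) x \<in> X \<and> norm ((Q ^^ n) x) \<le> q ^ n * norm x" if "x \<in> X" for n x
  proof (induction n)
    case (Suc n)
    have "norm (Q ((Q ^^ n) x)) \<le> q * norm ((Q ^^ n) x)" using Q_le Suc by blast
    also have "\<dots> \<le> q * (q ^ n * norm x)" using Suc lam by (intro mult_left_mono) auto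
    finally show ?case using Suc operator_mem[OF opQ] by (simp add: mult.assoc)
  qed (use that in simp)
  have Qn: "pos_operator (Q ^^ n)" for n
    by (induction n) (simp_all only: funpow.simps markovD(5)[OF markov_id] pos_operator_comp Q)
  have U_split: "\<exists>B. pos_operator B \<and> (\<forall>x\<in>X. (U ^^ n) x = V (B x) + (Q ^^ n) x)" for n
  proof (induction n)
    case 0
    then show ?case using pos_operator_zero operator_zero[OF opV] by (intro exI[of _ "\<lambda>x. 0"]) auto
  next
    case (Suc n)
    then obtain B where B: "pos_operator B" and eq: "\<And>x. x \<in> X \<Longrightarrow> (U ^^ n) x = V (B x) + (Q ^^ n) x"
      by blast
    \<comment> \<open>From \<open>U^n (V A + Q) = V U^n A + (V B + Q^n) Q\<close>, where the
      induction hypothesis is applied to \<open>U^n\<close> in front of \<open>Q\<close>.\<close>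
    let ?B = "\<lambda>x. ((U ^^ n) \<circ> A) x + (B \<circ> Q) x"
    have "pos_operator ?B"
      using markovD(5)[OF Un] A B Q by (intro pos_operator_add pos_operator_comp)
    moreover have "(U ^^ Suc n) x = V (?B x) + (Q ^^ Suc n) x" if x: "x \<in> X" for x
    proof -
      have mem: "A x \<in> X" "Q x \<in> X" "B (Q x) \<in> X" "V (A x) \<in> X"
        using x operator_mem[OF opA] operator_mem[OF opQ] operator_mem[OF opV]
          operator_mem[OF pos_operatorD(1)[OF B]] by auto
      have "(U ^^ Suc n) x = (U ^^ n) (V (A x) + Q x)"
        using split[OF x] by (simp add: funpow_swap1 V_def)
      also have "\<dots> = V ((U ^^ n) (A x)) + (V (B (Q x)) + (Q ^^ n) (Q x))"
        using mem by (simp add: operator_add[OF markovD(1)[OF Un]] UnV eq)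
      also have "\<dots> = V (?B x) + (Q ^^ Suc n) x"
        using mem memU by (simp add: operator_add[OF opV] funpow_swap1)
      finally show ?thesis .
    qed
    ultimately show ?case by blast
  qed
  \<comment> \<open>\<open>\<delta>\<close> is general in the induction: a round takes its
    predecessor with \<open>\<delta> / 2\<close> and spends the other half on
    \<open>Q^n\<close>.\<close>
  have V_split: "\<exists>N\<ge>1. \<exists>B R. pos_operator B \<and> pos_operator R \<and>
      (\<forall>x\<in>X. (U ^^ N) x = (V ^^ j) (B x) + R x \<and> norm (B x) \<le> norm x \<and> norm (R x) \<le> \<delta> * norm x)"
    if "0 < \<delta>" for j \<delta>
    using that
  proof (induction j arbitrary: \<delta>)
    case 0
    \<comment> \<open>Starting from the exponent 1 rather than 0 secures \<open>N \<ge> 1\<close>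
      throughout.\<close>
    show ?case
    proof (intro exI[of _ "1::nat"] conjI)
      show "\<exists>B R. pos_operator B \<and> pos_operator R \<and> (\<forall>x\<in>X. (U ^^ 1) x = (V ^^ 0) (B x) + R x
          \<and> norm (B x) \<le> norm x \<and> norm (R x) \<le> \<delta> * norm x)"
        using 0 markovD(5)[OF U] pos_operator_zero markovD(3)[OF U]
        by - (rule exI[of _ U], rule exI[of _ "\<lambda>x. 0"], auto)
    qed simp
  next
    case (Suc j)
    have half: "0 < \<delta> / 2" using Suc.prems by simp
    obtain N B R where N: "N \<ge> 1" and B: "pos_operator B" and R: "pos_operator R"
      and NBR: "\<And>x. x \<in> X \<Longrightarrow> (U ^^ N) x = (V ^^ j) (B x) + R x"
        "\<And>x. x \<in> X \<Longrightarrow> norm (B x) \<le> norm x" "\<And>x. x \<in> X \<Longrightarrow> norm (R x) \<le> (\<delta> / 2) * norm x"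
      using Suc.IH[OF half] by blast
    obtain n where n: "q ^ n < \<delta> / 2"
      using real_arch_pow_inv[OF half lam(2)] by blast
    obtain C where C: "pos_operator C" and eq: "\<And>x. x \<in> X \<Longrightarrow> (U ^^ n) x = V (C x) + (Q ^^ n) x"
      using U_split by blast
    \<comment> \<open>\<open>U^n\<close> is moved past \<open>V^j\<close> and split in front of
      \<open>B\<close>: \<open>U^n V^j B = V^j (V C + Q^n) B\<close>. What lacks the additional
      \<open>V\<close> goes into the remainder.\<close>
    let ?B = "C \<circ> B" and ?R = "\<lambda>x. ((V ^^ j) \<circ> ((Q ^^ n) \<circ> B)) x + ((U ^^ n) \<circ> R) x"
    have posB: "pos_operator ?B" using C B by (rule pos_operator_comp)
    have posR: "pos_operator ?R"
      using markovD(5)[OF Un] markovD(5)[OF Vn] Qn B R by (intro pos_operator_add pos_operator_comp)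
    have memB: "B x \<in> X" "R x \<in> X" "C (B x) \<in> X" if "x \<in> X" for x
      using that operator_mem[OF pos_operatorD(1)[OF B]] operator_mem[OF pos_operatorD(1)[OF C]]
        operator_mem[OF pos_operatorD(1)[OF R]] by simp_all
    have sum: "(U ^^ (n + N)) x = (V ^^ Suc j) (?B x) + ?R x" if x: "x \<in> X" for x
    proof -
      note mem = memB[OF x]
      have "(U ^^ (n + N)) x = (U ^^ n) ((V ^^ j) (B x) + R x)"
        using NBR(1)[OF x] by (simp add: funpow_add)
      also have "\<dots> = (V ^^ j) (V (C (B x)) + (Q ^^ n) (B x)) + (U ^^ n) (R x)"
        using mem memV by (simp add: operator_add[OF markovD(1)[OF Un]] UnVj eq)
      also have "\<dots> = (V ^^ Suc j) (?B x) + ?R x"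
        using mem Qn_le operator_mem[OF opV] by (simp add: operator_add[OF markovD(1)[OF Vn]] funpow_swap1)
      finally show ?thesis .
    qed
    have R_le: "norm (?R x) \<le> \<delta> * norm x" if x: "x \<in> X" for x
    proof -
      note mem = memB[OF x]
      have "norm ((V ^^ j) ((Q ^^ n) (B x))) \<le> norm ((Q ^^ n) (B x))"
        using markovD(3)[OF Vn] Qn_le[OF mem(1)] by blast
      also have "\<dots> \<le> q ^ n * norm (B x)" using Qn_le[OF mem(1)] by blast
      also have "\<dots> \<le> (\<delta> / 2) * norm x" using n NBR(2)[OF x] lam half by (intro mult_mono) auto
      finally have 1: "norm ((V ^^ j) ((Q ^^ n) (B x))) \<le> (\<delta> / 2) * norm x" .
      have 2: "norm ((U ^^ n) (R x)) \<le> (\<delta> / 2) * norm x"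
        using markovD(3)[OF Un mem(2)] NBR(3)[OF x] by (rule order_trans)
      have "norm (?R x) \<le> norm ((V ^^ j) ((Q ^^ n) (B x))) + norm ((U ^^ n) (R x))"
        by (simp add: norm_triangle_ineq)
      also have "\<dots> \<le> \<delta> * norm x" using 1 2 by simp
      finally show ?thesis .
    qed
    text \<open>The explicit factor \<open>C \<circ> B\<close> is only bounded by a power of \<open>1 / (1 - q)\<close>; positivity is what
      makes it a contraction.\<close>
    have B_le: "norm (?B x) \<le> norm x" if x: "x \<in> X" for x
    proof -
      have "norm (?B p) \<le> 1 * norm p" if p: "p \<in> P" for p
      proof -
        have Bp: "?B p \<in> P" and Rp: "?R p \<in> P"
          using pos_operatorD(2)[OF posB p] pos_operatorD(2)[OF posR p] by blast+
        have "norm (?B p) = norm ((V ^^ Suc j) (?B p))" using markovD(4)[OF Vn Bp] by (rule sym)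
        also have "\<dots> \<le> norm ((V ^^ Suc j) (?B p)) + norm (?R p)" by simp
        also have "\<dots> = norm ((V ^^ Suc j) (?B p) + ?R p)"
          using markovD(2)[OF Vn Bp] Rp by (rule norm_add_P[symmetric])
        also have "\<dots> = norm ((U ^^ (n + N)) p)" using sum p by simp
        also have "\<dots> = norm p" using markovD(4)[OF Un p] .
        finally show ?thesis by simp
      qed
      from norm_le_from_cone[OF posB _ this x] show ?thesis by simp
    qed
    show ?case
    proof (intro exI[of _ "n + N"] conjI)
      show "\<exists>B R. pos_operator B \<and> pos_operator R \<and> (\<forall>x\<in>X. (U ^^ (n + N)) x = (V ^^ Suc j) (B x) + R x
          \<and> norm (B x) \<le> norm x \<and> norm (R x) \<le> \<delta> * norm x)"
        using posB posR sum R_le B_le by blast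
    qed (use N in simp)
  qed
  obtain j where j: "2 / sqrt (Suc j) < e / 2"
  proof -
    have "(\<lambda>j. 2 / sqrt (real (Suc j))) \<longlonglongrightarrow> 0"
      by (intro tendsto_divide_0[OF tendsto_const] filterlim_at_top_imp_at_infinity
          filterlim_compose[OF sqrt_at_top] filterlim_compose[OF filterlim_real_sequentially filterlim_Suc])
    then have "\<forall>\<^sub>F j in sequentially. 2 / sqrt (real (Suc j)) < e / 2"
      using e by (intro order_tendstoD(2)) auto
    then show ?thesis using that by (meson eventually_happens sequentially_bot)
  qed
  \<comment> \<open>Applying \<open>W - 1\<close> at most doubles the remainder, hence
    \<open>e / 4\<close>; the choice of \<open>j\<close> pays the other half of
    \<open>e\<close>.\<close>
  obtain N B R where N: "N \<ge> 1" and B: "pos_operator B" and R: "pos_operator R"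
    and NBR: "\<And>x. x \<in> X \<Longrightarrow> (U ^^ N) x = (V ^^ j) (B x) + R x"
      "\<And>x. x \<in> X \<Longrightarrow> norm (B x) \<le> norm x" "\<And>x. x \<in> X \<Longrightarrow> norm (R x) \<le> (e / 4) * norm x"
    using V_split[of "e / 4" j] e by (metis divide_pos_pos zero_less_numeral)
  show ?thesis
  proof (intro exI[of _ N] conjI N ballI)
    fix x assume x: "x \<in> X"
    have mem: "B x \<in> X" "R x \<in> X" "W x \<in> X" "W (B x) \<in> X" "W (R x) \<in> X"
      using x operator_mem[OF pos_operatorD(1)[OF B]] operator_mem[OF pos_operatorD(1)[OF R]]
        operator_mem[OF opW] by simp_all
    have UW: "(U ^^ N) (W x) = W ((U ^^ N) x)"
      using commute_on_funpow[OF comm opU opW] x by (simp add: commute_on_def)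
    have "commute_on X V W"
      by (simp add: commute_on_def V_def operator_scale[OF opW] operator_add[OF opW] operator_mem[OF opW])
    then have VW: "(V ^^ j) (W (B x)) = W ((V ^^ j) (B x))"
      using commute_on_funpow[OF _ opV opW] mem by (simp add: commute_on_def)
    have "(U ^^ N) (W x - x) = W ((U ^^ N) x) - (U ^^ N) x"
      using x mem by (simp add: operator_diff[OF markovD(1)[OF Un]] UW)
    also have "\<dots> = (W ((V ^^ j) (B x)) + W (R x)) - ((V ^^ j) (B x) + R x)"
      using x mem memV by (simp add: NBR(1) operator_add[OF opW])
    also have "\<dots> = (V ^^ j) (W (B x) - B x) + (W (R x) - R x)"
      using mem by (simp add: operator_diff[OF markovD(1)[OF Vn]] VW)
    finally have eq: "(U ^^ N) (W x - x) = (V ^^ j) (W (B x) - B x) + (W (R x) - R x)" .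
    have "norm ((V ^^ j) (W (B x) - B x)) \<le> 2 / sqrt (Suc j) * norm (B x)"
      using average_power_difference[OF W mem(1), of j] by (simp add: V_def[abs_def])
    also have "\<dots> \<le> (e / 2) * norm x"
      using j NBR(2)[OF x] e by (intro mult_mono) auto
    finally have 1: "norm ((V ^^ j) (W (B x) - B x)) \<le> (e / 2) * norm x" .
    have 2: "norm (W (R x) - R x) \<le> (e / 2) * norm x"
      using norm_triangle_ineq4[of "W (R x)" "R x"] markovD(3)[OF W mem(2)] NBR(3)[OF x] by simp
    show "norm ((U ^^ N) (W x - x)) \<le> e * norm x"
      unfolding eq using norm_triangle_ineq[of "(V ^^ j) (W (B x) - B x)" "W (R x) - R x"] 1 2 by simp
  qed
qed

lemma opnorm_on_bound:
  assumes f: "operator_on X f" and lt: "opnorm_on X f < 1"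
  obtains c where "0 \<le> c" "c < 1" "\<And>x. x \<in> X \<Longrightarrow> norm (f x) \<le> c * norm x"
proof (rule that[of "enn2real (opnorm_on X f)"])
  have fin: "ennreal (enn2real (opnorm_on X f)) = opnorm_on X f"
    using lt by (simp add: ennreal_enn2real order_less_trans)
  show "0 \<le> enn2real (opnorm_on X f)" by simp
  show "enn2real (opnorm_on X f) < 1"
    using lt fin by (metis ennreal_1 ennreal_less_iff enn2real_nonneg)
  fix x assume x: "x \<in> X"
  show "norm (f x) \<le> enn2real (opnorm_on X f) * norm x"
  proof (cases "x = 0")
    case True
    then show ?thesis using operator_zero[OF f] by simp
  next
    case False
    let ?u = "(1 / norm x) *\<^sub>R x"
    have u: "?u \<in> X" "norm ?u = 1" using x False by auto
    have "ennreal (norm (f ?u)) \<le> opnorm_on X f"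
      unfolding opnorm_on_def by (rule SUP_upper) (use u in auto)
    then have "norm (f ?u) \<le> enn2real (opnorm_on X f)"
      using fin by (metis ennreal_le_iff enn2real_nonneg)
    then show ?thesis using False x by (simp add: operator_scale[OF f] field_simps)
  qed
qed

text \<open>The gap between \<open>c\<close> and \<open>e\<close> matters: a supremum of values
  below \<open>e\<close> could equal \<open>e\<close>.\<close>

lemma opnorm_on_less:
  assumes "\<And>x. x \<in> X \<Longrightarrow> norm (f x) \<le> c * norm x" "0 \<le> c" "c < e"
  shows "opnorm_on X f < ennreal e"
proof -
  have "opnorm_on X f \<le> ennreal c"
    unfolding opnorm_on_def
  proof (rule SUP_least)
    fix x assume "x \<in> {x \<in> X. norm x = 1}"
    then show "ennreal (norm (f x)) \<le> ennreal c" using assms(1)[of x] by (simp add: ennreal_leI)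
  qed
  also have "\<dots> < ennreal e" using assms by (simp add: ennreal_lessI)
  finally show ?thesis .
qed

end

section \<open>Commuting families and multi-indices\<close>

locale commuting_markov_family = cone_space X P for X P :: "'l :: real_normed_vector set" +
  fixes d :: nat and T :: "nat \<Rightarrow> 'l \<Rightarrow> 'l"
  assumes markov_T: "\<And>i. i \<in> {1..d} \<Longrightarrow> markov (T i)"
    and commute_T: "\<And>i j. i \<in> {1..d} \<Longrightarrow> j \<in> {1..d} \<Longrightarrow> commute_on X (T i) (T j)"
begin

text \<open>The index list is a free argument so that the product over \<open>[1..<Suc d]\<close>
  becomes accessible to induction.\<close>

primrec list_pow :: "nat list \<Rightarrow> (nat \<Rightarrow> nat) \<Rightarrow> 'l \<Rightarrow> 'l" where
  "list_pow [] n x = x"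
| "list_pow (i # xs) n x = (T i ^^ n i) (list_pow xs n x)"

lemma markov_list_pow: "set xs \<subseteq> {1..d} \<Longrightarrow> markov (list_pow xs n)"
proof (induction xs)
  case Nil
  have "list_pow [] n = id" by (simp add: fun_eq_iff)
  then show ?case by (simp only: markov_id)
next
  case (Cons i xs)
  have "list_pow (i # xs) n = (T i ^^ n i) \<circ> list_pow xs n" by (simp add: fun_eq_iff)
  moreover have "markov (T i ^^ n i)" "markov (list_pow xs n)"
    using Cons by (simp_all add: markov_funpow markov_T)
  ultimately show ?case by (simp only: markov_comp)
qed

lemma list_pow_mem: "set xs \<subseteq> {1..d} \<Longrightarrow> x \<in> X \<Longrightarrow> list_pow xs n x \<in> X"
  using operator_mem[OF markovD(1)[OF markov_list_pow]] by blast

lemma commute_list_pow: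
  assumes f: "operator_on X f" and comm: "\<And>i. i \<in> {1..d} \<Longrightarrow> commute_on X f (T i)"
  shows "set xs \<subseteq> {1..d} \<Longrightarrow> commute_on X f (list_pow xs n)"
proof (induction xs)
  case Nil
  then show ?case by (simp add: commute_on_def)
next
  case (Cons i xs)
  have "commute_on X f (T i ^^ n i)"
    using Cons.prems commute_on_funpow[OF commute_on_sym[OF comm] markovD(1)[OF markov_T] f]
    by (simp add: commute_on_sym)
  then show ?case using Cons list_pow_mem[of xs] by (simp add: commute_on_def)
qed

text \<open>The power of the head operator with exponent from \<open>n\<close> has to pass the
  powers of all later operators with exponents from \<open>m\<close>; this is where the members of
  the family must commute.\<close>

lemma list_pow_add:
  "set xs \<subseteq> {1..d} \<Longrightarrow> x \<in> X \<Longrightarrow> list_pow xs (\<lambda>i. m i + n i) x = list_pow xs m (list_pow xs n x)"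
proof (induction xs)
  case (Cons i xs)
  then have i: "i \<in> {1..d}" and xs: "set xs \<subseteq> {1..d}" by auto
  have op: "operator_on X (T i ^^ n i)" using markovD(1)[OF markov_funpow[OF markov_T[OF i]]] .
  have "commute_on X (T i ^^ n i) (list_pow xs m)"
    using commute_on_funpow[OF commute_T[OF i] markovD(1)[OF markov_T[OF i]] markovD(1)[OF markov_T]]
    by (intro commute_list_pow[OF op] xs)
  then have "(T i ^^ n i) (list_pow xs m (list_pow xs n x)) = list_pow xs m ((T i ^^ n i) (list_pow xs n x))"
    using list_pow_mem[OF xs Cons.prems(2)] by (simp add: commute_on_def)
  then show ?case using Cons by (simp add: funpow_add)
qed simp

lemma multi_pow_list: "multi_pow d T n = list_pow [1..<Suc d] n"
proof -
  have "foldr (\<lambda>i f. (T i ^^ n i) \<circ> f) xs id = list_pow xs n" for xs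
    by (induction xs) (simp_all add: fun_eq_iff)
  then show ?thesis by (simp only: multi_pow_def)
qed

lemma set_range: "set [1..<Suc d] \<subseteq> {1..d}"
  by auto

lemma markov_multi_pow: "markov (multi_pow d T n)"
  unfolding multi_pow_list by (rule markov_list_pow[OF set_range])

lemma multi_pow_add:
  "x \<in> X \<Longrightarrow> multi_pow d T (\<lambda>i. m i + n i) x = multi_pow d T m (multi_pow d T n x)"
  unfolding multi_pow_list by (rule list_pow_add[OF set_range])

lemma commute_multi_pow:
  "operator_on X f \<Longrightarrow> (\<And>i. i \<in> {1..d} \<Longrightarrow> commute_on X f (T i)) \<Longrightarrow> commute_on X f (multi_pow d T n)"
  unfolding multi_pow_list by (rule commute_list_pow[OF _ _ set_range])

lemma multi_pow_cong:
  "(\<And>i. i \<in> {1..d} \<Longrightarrow> m i = n i) \<Longrightarrow> multi_pow d T m = multi_pow d T n"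
  unfolding multi_pow_def by (rule foldr_cong) (auto simp del: upt_Suc)

text \<open>Passage from the single operator \<open>W = T^k\<close> to all \<open>n\<close> beyond a
  threshold: \<open>T^(n - n0)\<close> is a contraction that commutes with
  \<open>T^k\<close>.\<close>

lemma zero_two_law_multi:
  assumes Z: "markov Z" and S: "pos_operator S"
    and ZT: "\<And>i. i \<in> {1..d} \<Longrightarrow> commute_on X Z (T i)"
    and le1: "le_on P (\<lambda>x. Z (S x)) (\<lambda>x. Z (multi_pow d T (\<lambda>i. m i + k i) x))"
    and le2: "le_on P (\<lambda>x. Z (S x)) (\<lambda>x. Z (multi_pow d T m x))"
    and lt1: "opnorm_on X (\<lambda>x. Z (multi_pow d T (\<lambda>i. m i + k i) x - S x)) < 1"
    and lt2: "opnorm_on X (\<lambda>x. Z (multi_pow d T m x - S x)) < 1"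
    and e: "0 < \<epsilon>"
  shows "\<exists>N\<ge>1. \<exists>n0 :: nat \<Rightarrow> nat. \<forall>n :: nat \<Rightarrow> nat. (\<forall>i\<in>{1..d}. n0 i \<le> n i) \<longrightarrow>
    opnorm_on X (\<lambda>x. (Z ^^ N) (multi_pow d T (\<lambda>i. n i + k i) x - multi_pow d T n x)) < ennreal \<epsilon>"
proof -
  let ?T = "multi_pow d T" and ?mk = "\<lambda>i. m i + k i"
  note opZ = markovD(1)[OF Z] and opS = pos_operatorD(1)[OF S]
  note Tn = markov_multi_pow and opT = markovD(1)[OF markov_multi_pow]
  note mem = operator_mem[OF opZ] operator_mem[OF opS] operator_mem[OF opT]
  have Z_T: "Z (?T n x) = ?T n (Z x)" if "x \<in> X" for n x
    using commute_multi_pow[OF opZ ZT] that by (simp add: commute_on_def)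
  have T_T: "?T a (?T b x) = ?T b (?T a x)" if "x \<in> X" for a b x
    using that by (simp flip: multi_pow_add add: add.commute)
  \<comment> \<open>The norm hypothesis concerns \<open>Z (T^n - S)\<close>, the order hypothesis
    \<open>Z T^n - Z S\<close>. Linearity of \<open>Z\<close> on \<open>X\<close> identifies the
    two, so one operator is both positive and strictly contractive.\<close>
  have remainder: "pos_operator (\<lambda>x. Z (?T n x) - Z (S x)) \<and>
      (\<exists>c. 0 \<le> c \<and> c < 1 \<and> (\<forall>x\<in>X. norm (Z (?T n x) - Z (S x)) \<le> c * norm x))"
    if le: "le_on P (\<lambda>x. Z (S x)) (\<lambda>x. Z (?T n x))" and lt: "opnorm_on X (\<lambda>x. Z (?T n x - S x)) < 1" for n
  proof -
    have "operator_on X (Z \<circ> (\<lambda>x. ?T n x - S x))"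
      by (intro operator_on_comp operator_on_diff opZ opT opS)
    then have "operator_on X (\<lambda>x. Z (?T n x - S x))" by (simp add: o_def)
    from opnorm_on_bound[OF this lt] obtain c where
      c: "0 \<le> c" "c < 1" "\<And>x. x \<in> X \<Longrightarrow> norm (Z (?T n x - S x)) \<le> c * norm x" by blast
    have bound: "norm (Z (?T n x) - Z (S x)) \<le> c * norm x" if "x \<in> X" for x
      using c(3)[OF that] that mem by (simp add: operator_diff[OF opZ])
    have "operator_on X (\<lambda>x. (Z \<circ> ?T n) x - (Z \<circ> S) x)"
      by (intro operator_on_comp operator_on_diff opZ opT opS)
    then have "pos_operator (\<lambda>x. Z (?T n x) - Z (S x))"
      using le bound by (intro pos_operatorI[where C = c]) (auto simp: le_on_def positive_on_def)
    then show ?thesis using c bound by blast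
  qed
  define R1 where "R1 x = Z (?T ?mk x) - Z (S x)" for x
  define R2 where "R2 x = Z (?T m x) - Z (S x)" for x
  obtain c1 where R1: "pos_operator R1" and c1: "0 \<le> c1" "c1 < 1" "\<And>x. x \<in> X \<Longrightarrow> norm (R1 x) \<le> c1 * norm x"
    using remainder[OF le1 lt1] by (auto simp: R1_def[abs_def])
  obtain c2 where R2: "pos_operator R2" and c2: "0 \<le> c2" "c2 < 1" "\<And>x. x \<in> X \<Longrightarrow> norm (R2 x) \<le> c2 * norm x"
    using remainder[OF le2 lt2] by (auto simp: R2_def[abs_def])
  note memR = operator_mem[OF pos_operatorD(1)[OF R1]] operator_mem[OF pos_operatorD(1)[OF R2]]
  \<comment> \<open>\<open>T^(2 m + k)\<close> is kept as two factors, so that either of them can be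
    joined to \<open>Z\<close> and minorised by \<open>Z S\<close>.\<close>
  define U where "U = Z \<circ> (?T m \<circ> ?T ?mk)"
  define A where "A = ?T m \<circ> (Z \<circ> S)"
  define Q where "Q x = (1/2) *\<^sub>R ((?T m \<circ> R1) x + (?T ?mk \<circ> R2) x)" for x
  have U: "markov U" unfolding U_def by (intro markov_comp Z Tn)
  have opU: "operator_on X U" using markovD(1)[OF U] .
  have U_apply: "U x = Z (?T m (?T ?mk x))" for x by (simp add: U_def)
  have A: "pos_operator A" unfolding A_def by (intro pos_operator_comp markovD(5) Tn Z S)
  have Q: "pos_operator Q"
    unfolding Q_def by (intro pos_operator_scale pos_operator_add pos_operator_comp markovD(5) Tn R1 R2) simp
  have Q_le: "norm (Q x) \<le> ((c1 + c2) / 2) * norm x" if x: "x \<in> X" for x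
  proof -
    have "norm (?T m (R1 x)) \<le> c1 * norm x"
      using markovD(3)[OF Tn memR(1)[OF x]] c1(3)[OF x] by (rule order_trans)
    moreover have "norm (?T ?mk (R2 x)) \<le> c2 * norm x"
      using markovD(3)[OF Tn memR(2)[OF x]] c2(3)[OF x] by (rule order_trans)
    ultimately show ?thesis
      using norm_triangle_ineq[of "?T m (R1 x)" "?T ?mk (R2 x)"]
      by (simp add: Q_def add_divide_distrib distrib_right)
  qed
  have comm: "commute_on X U (?T k)"
    unfolding commute_on_def
  proof
    fix x assume x: "x \<in> X"
    have "?T m (?T ?mk (?T k x)) = ?T k (?T m (?T ?mk x))"
      using T_T[OF x, of ?mk k] T_T[of "?T ?mk x" m k] x mem by simp
    then show "U (?T k x) = ?T k (U x)"
      using x mem Z_T[of "?T m (?T ?mk x)" k] by (simp add: U_def)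
  qed
  \<comment> \<open>Equation \<open>1\<close> joins \<open>Z\<close> to \<open>T^(m+k)\<close>,
    equation \<open>2\<close> joins it to \<open>T^m\<close>; in the latter the surplus
    \<open>T^k\<close> ends up in front of \<open>A\<close>. The mean of both is the claim.\<close>
  have split: "U x = (1/2) *\<^sub>R (A x + ?T k (A x)) + Q x" if x: "x \<in> X" for x
  proof -
    have "U x = ?T m (Z (?T ?mk x))" using x mem by (simp add: U_def Z_T)
    also have "\<dots> = ?T m (Z (S x) + R1 x)" by (simp add: R1_def)
    also have "\<dots> = A x + ?T m (R1 x)" using x mem memR by (simp add: operator_add[OF opT] A_def)
    finally have 1: "U x = A x + ?T m (R1 x)" .
    have "U x = ?T ?mk (Z (?T m x))" using x mem by (simp add: U_def Z_T T_T[of x m ?mk])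
    also have "\<dots> = ?T ?mk (Z (S x) + R2 x)" by (simp add: R2_def)
    also have "\<dots> = ?T ?mk (Z (S x)) + ?T ?mk (R2 x)" using x mem memR by (simp add: operator_add[OF opT])
    also have "?T ?mk (Z (S x)) = ?T k (A x)"
      using x mem T_T[of "Z (S x)" k m] by (simp add: A_def multi_pow_add)
    finally have 2: "U x = ?T k (A x) + ?T ?mk (R2 x)" .
    have "U x = (1/2) *\<^sub>R (U x + U x)" by (simp flip: scaleR_2)
    also have "U x + U x = (A x + ?T m (R1 x)) + (?T k (A x) + ?T ?mk (R2 x))"
      using 1 2 by simp
    finally show ?thesis by (simp add: Q_def scaleR_add_right add_ac)
  qed
  \<comment> \<open>The mean of \<open>c1\<close> and \<open>c2\<close> is below 1;
    \<open>\<epsilon> / 2\<close> leaves room for the strict inequality.\<close>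
  obtain N where N: "N \<ge> 1" and small: "\<And>x. x \<in> X \<Longrightarrow> norm ((U ^^ N) (?T k x - x)) \<le> (\<epsilon> / 2) * norm x"
    using zero_two_law[OF U Tn comm A Q split _ _ Q_le, of "\<epsilon> / 2"] c1 c2 e by auto
  \<comment> \<open>This is the exponent of \<open>T\<close> in \<open>U^N\<close>.\<close>
  define n0 where "n0 i = N * (m i + ?mk i)" for i
  have U_pow: "(U ^^ N) x = (Z ^^ N) (?T n0 x)" if x: "x \<in> X" for x
  proof -
    have "(U ^^ r) x = (Z ^^ r) (?T (\<lambda>i. r * (m i + ?mk i)) x) \<and> (U ^^ r) x \<in> X" for r
    proof (induction r)
      case 0
      have "list_pow xs (\<lambda>i. 0) x = x" for xs by (induction xs) simp_all
      then show ?case using x by (simp add: multi_pow_list)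
    next
      case (Suc r)
      let ?y = "?T (\<lambda>i. r * (m i + ?mk i)) x"
      have y: "?y \<in> X" "?T m (?T ?mk ?y) \<in> X" using mem x by auto
      have Zr: "operator_on X (Z ^^ r)" using markovD(1)[OF markov_funpow[OF Z]] .
      have ZrT: "(Z ^^ r) (?T n v) = ?T n ((Z ^^ r) v)" if "v \<in> X" for n v
        using commute_on_funpow[OF commute_multi_pow[OF opZ ZT] opZ opT] that by (simp add: commute_on_def)
      have Ur: "(U ^^ r) x = (Z ^^ r) ?y" using Suc by blast
      have "(U ^^ Suc r) x = Z (?T m (?T ?mk ((Z ^^ r) ?y)))"
        by (simp only: funpow.simps comp_apply Ur U_apply)
      also have "\<dots> = Z ((Z ^^ r) (?T m (?T ?mk ?y)))" using y mem by (simp add: ZrT)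
      also have "?T m (?T ?mk ?y) = ?T (\<lambda>i. m i + (?mk i + r * (m i + ?mk i))) x"
        using x mem by (simp add: multi_pow_add)
      finally have "(U ^^ Suc r) x = (Z ^^ Suc r) (?T (\<lambda>i. Suc r * (m i + ?mk i)) x)"
        by (simp add: add.assoc)
      moreover have "(U ^^ Suc r) x \<in> X"
        using operator_mem[OF opU conjunct2[OF Suc]] by simp
      ultimately show ?case by blast
    qed
    then show ?thesis by (simp add: n0_def[abs_def])
  qed
  show ?thesis
  proof (intro exI[of _ N] conjI N exI[of _ n0] allI impI)
    fix n :: "nat \<Rightarrow> nat" assume n: "\<forall>i\<in>{1..d}. n0 i \<le> n i"
    \<comment> \<open>Truncated subtraction is undone by adding \<open>n0\<close> only on
      \<open>{1..d}\<close>, which is all that \<open>multi_pow\<close> sees.\<close>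
    define r where "r i = n i - n0 i" for i
    have Tn_eq: "?T n = ?T (\<lambda>i. n0 i + r i)" and Tnk_eq: "?T (\<lambda>i. n i + k i) = ?T (\<lambda>i. n0 i + (r i + k i))"
      using n by (auto intro!: multi_pow_cong simp: r_def simp flip: add.assoc)
    show "opnorm_on X (\<lambda>x. (Z ^^ N) (?T (\<lambda>i. n i + k i) x - ?T n x)) < ennreal \<epsilon>"
    proof (rule opnorm_on_less[where c = "\<epsilon> / 2"])
      fix x assume x: "x \<in> X"
      let ?y = "?T r x"
      have y: "?y \<in> X" using x mem by blast
      have "?T (\<lambda>i. n i + k i) x - ?T n x = ?T n0 (?T k ?y - ?y)"
        unfolding Tn_eq Tnk_eq using x y mem by (simp add: multi_pow_add operator_diff[OF opT] T_T[of x r k])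
      then have "norm ((Z ^^ N) (?T (\<lambda>i. n i + k i) x - ?T n x)) = norm ((U ^^ N) (?T k ?y - ?y))"
        using y mem by (simp add: U_pow)
      also have "\<dots> \<le> (\<epsilon> / 2) * norm ?y" using y by (rule small)
      also have "\<dots> \<le> (\<epsilon> / 2) * norm x" using markovD(3)[OF Tn x] e by (intro mult_left_mono) auto
      finally show "norm ((Z ^^ N) (?T (\<lambda>i. n i + k i) x - ?T n x)) \<le> (\<epsilon> / 2) * norm x" .
    qed (use e in auto)
  qed
qed

end

section \<open>Positive operators and their square roots\<close>

text \<open>The operators of the library type are real-linear, and square roots and order can be
  treated over the reals, so only the real part is kept. Complex linearity enters again through
  \<open>bounded_ops\<close>.\<close>

definition rip :: "'h :: complex_hilbert \<Rightarrow> 'h \<Rightarrow> real" where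
  "rip x y = Re (cinner x y)"

lemma cinner_scaleR_right: "cinner x (r *\<^sub>R y) = of_real r * cinner x (y :: 'h :: complex_hilbert)"
  by (simp add: scaleR_scaleC cinner_scaleC_right)

lemma rip_commute: "rip x y = rip y (x :: 'h :: complex_hilbert)"
  unfolding rip_def by (subst cinner_commute) simp

lemma rip_add_right: "rip x (y + z) = rip x y + rip x (z :: 'h :: complex_hilbert)"
  by (simp add: rip_def cinner_add_right)

lemma rip_scaleR_right: "rip x (r *\<^sub>R y) = r * rip x (y :: 'h :: complex_hilbert)"
  by (simp add: rip_def cinner_scaleR_right)

lemma rip_add_left: "rip (x + y) z = rip x z + rip y (z :: 'h :: complex_hilbert)"
  by (metis rip_add_right rip_commute)

lemma rip_scaleR_left: "rip (r *\<^sub>R x) y = r * rip x (y :: 'h :: complex_hilbert)"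
  by (metis rip_scaleR_right rip_commute)

lemma rip_diff_right: "rip x (y - z) = rip x y - rip x (z :: 'h :: complex_hilbert)"
  using rip_add_right[of x "y - z" z] by simp

lemma rip_diff_left: "rip (x - y) z = rip x z - rip y (z :: 'h :: complex_hilbert)"
  by (metis rip_diff_right rip_commute)

lemma rip_zero [simp]: "rip x 0 = 0" "rip 0 x = 0" for x :: "'h :: complex_hilbert"
  using rip_scaleR_right[of x 0] rip_scaleR_left[of 0 x] by simp_all

lemmas rip_simps = rip_add_right rip_add_left rip_scaleR_right rip_scaleR_left rip_diff_right rip_diff_left

lemma rip_self: "rip x x = (norm (x :: 'h :: complex_hilbert))\<^sup>2"
proof -
  \<comment> \<open>In HOL the \<open>sqrt\<close> of a negative real is negative, so nonnegativity
    of the norm already forces that of the inner product.\<close>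
  have "0 \<le> sqrt (Re (cinner x x))" by (simp flip: norm_eq_sqrt_cinner)
  then have "0 \<le> Re (cinner x x)" by simp
  then show ?thesis by (simp add: rip_def norm_eq_sqrt_cinner)
qed

lemma rip_nonneg [simp]: "0 \<le> rip x (x :: 'h :: complex_hilbert)"
  by (simp add: rip_self)

lemma eq_from_rip: "(\<And>y. rip y x = rip y z) \<Longrightarrow> x = (z :: 'h :: complex_hilbert)"
  using rip_self[of "x - z"] by (simp add: rip_simps)

section \<open>Symmetric and positive semidefinite operators\<close>

definition sym_op :: "('h :: complex_hilbert \<Rightarrow>\<^sub>L 'h) \<Rightarrow> bool" where
  "sym_op A \<longleftrightarrow> (\<forall>x y. rip (A x) y = rip x (A y))"

text \<open>Symmetry is part of the notion: over the reals it does not follow from nonnegativity of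
  the quadratic form.\<close>

definition psd_op :: "('h :: complex_hilbert \<Rightarrow>\<^sub>L 'h) \<Rightarrow> bool" where
  "psd_op A \<longleftrightarrow> sym_op A \<and> (\<forall>x. 0 \<le> rip x (A x))"

lemma sym_opD: "sym_op A \<Longrightarrow> rip (A x) y = rip x (A y)"
  by (simp add: sym_op_def)

lemma psd_opD: "psd_op A \<Longrightarrow> sym_op A" "psd_op A \<Longrightarrow> 0 \<le> rip x (A x)"
  by (simp_all add: psd_op_def)

lemma quadratic_nonneg_discriminant:
  fixes a b c :: real
  assumes nonneg: "\<And>t. 0 \<le> a + 2 * t * b + t\<^sup>2 * c" and "0 \<le> c"
  shows "b\<^sup>2 \<le> a * c"
proof (cases "c = 0")
  case True
  have "b = 0"
  proof (rule ccontr)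
    assume "b \<noteq> 0"
    \<comment> \<open>At this \<open>t\<close> the affine expression equals -1.\<close>
    then show False using nonneg[of "- (a + 1) / (2 * b)"] True by (simp add: field_simps)
  qed
  then show ?thesis using True by simp
next
  case False
  then have c: "c > 0" using assms by simp
  have "0 \<le> a - b\<^sup>2 / c"
    using nonneg[of "- b / c"] c by (simp add: power2_eq_square field_simps)
  then show ?thesis using c by (simp add: field_simps)
qed

lemma psd_cauchy_schwarz:
  assumes A: "psd_op A"
  shows "(rip x (A y))\<^sup>2 \<le> rip x (A x) * rip y (A y)"
proof (rule quadratic_nonneg_discriminant)
  fix t :: real
  have "0 \<le> rip (x + t *\<^sub>R y) (A (x + t *\<^sub>R y))" using A by (rule psd_opD)
  also have "rip y (A x) = rip x (A y)"
    using sym_opD[OF psd_opD(1)[OF A], of y x] by (metis rip_commute)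
  then have "rip (x + t *\<^sub>R y) (A (x + t *\<^sub>R y)) = rip x (A x) + 2 * t * rip x (A y) + t\<^sup>2 * rip y (A y)"
    by (simp add: blinfun.add_right blinfun.scaleR_right rip_simps power2_eq_square algebra_simps)
  finally show "0 \<le> rip x (A x) + 2 * t * rip x (A y) + t\<^sup>2 * rip y (A y)" .
qed (use A in \<open>simp add: psd_opD\<close>)

lemma sym_op_id: "sym_op id_blinfun"
  by (simp add: sym_op_def)

lemma psd_op_id: "psd_op id_blinfun"
  by (simp add: psd_op_def sym_op_id)

lemma rip_bound: "\<bar>rip x y\<bar> \<le> norm x * norm (y :: 'h :: complex_hilbert)"
proof (rule power2_le_imp_le)
  show "\<bar>rip x y\<bar>\<^sup>2 \<le> (norm x * norm y)\<^sup>2"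
    using psd_cauchy_schwarz[OF psd_op_id, of x y] by (simp add: rip_self power_mult_distrib)
qed simp

lemma bounded_bilinear_rip: "bounded_bilinear (rip :: 'h :: complex_hilbert \<Rightarrow> 'h \<Rightarrow> real)"
proof
  show "\<exists>K. \<forall>x y :: 'h. norm (rip x y) \<le> norm x * norm y * K"
    by (rule exI[of _ 1]) (simp add: rip_bound)
qed (simp_all add: rip_simps)

lemma psd_op_kernel:
  assumes A: "psd_op A" and "rip x (A x) = 0"
  shows "A x = 0"
proof -
  have "(rip (A x) (A x))\<^sup>2 \<le> 0"
    using psd_cauchy_schwarz[OF A, of "A x" x] assms by simp
  then show ?thesis by (simp add: rip_self)
qed

text \<open>The Cauchy-Schwarz inequality for the form of \<open>A\<close> at \<open>A x\<close> and
  \<open>x\<close>, with the form bound used at both vectors, gives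
  \<open>|A x|^4 <= |A x|^2 * |x|^2\<close>.\<close>

lemma psd_op_norm_le:
  assumes A: "psd_op A" and le: "\<And>x. rip x (A x) \<le> (norm x)\<^sup>2"
  shows "norm A \<le> 1"
proof (rule norm_blinfun_bound)
  fix x
  have "((norm (A x))\<^sup>2)\<^sup>2 \<le> rip (A x) (A (A x)) * rip x (A x)"
    using psd_cauchy_schwarz[OF A, of "A x" x] by (simp add: rip_self)
  also have "\<dots> \<le> (norm (A x))\<^sup>2 * (norm x)\<^sup>2"
    using A by (intro mult_mono le) (auto simp: psd_opD)
  finally have *: "(norm (A x))\<^sup>2 * (norm (A x))\<^sup>2 \<le> (norm (A x))\<^sup>2 * (norm x)\<^sup>2"
    by (simp only: power2_eq_square)
  have "(norm (A x))\<^sup>2 \<le> (norm x)\<^sup>2"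
  proof (cases "A x = 0")
    case False
    then have "0 < (norm (A x))\<^sup>2" by simp
    then show ?thesis using * by (simp only: mult_le_cancel_left_pos)
  qed simp
  then have "norm (A x) \<le> norm x" by (rule power2_le_imp_le) simp
  then show "norm (A x) \<le> 1 * norm x" by simp
qed simp

lemma sym_op_add: "sym_op A \<Longrightarrow> sym_op B \<Longrightarrow> sym_op (A + B)"
  and sym_op_diff: "sym_op A \<Longrightarrow> sym_op B \<Longrightarrow> sym_op (A - B)"
  and sym_op_scaleR: "sym_op A \<Longrightarrow> sym_op (r *\<^sub>R A)"
  by (simp_all add: sym_op_def blinfun.add_left blinfun.diff_left blinfun.scaleR_left rip_simps)

lemma sym_op_square: "sym_op A \<Longrightarrow> sym_op (A o\<^sub>L A)"
  by (simp add: sym_op_def)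

lemma psd_op_square: "sym_op A \<Longrightarrow> psd_op (A o\<^sub>L A)"
  by (simp add: psd_op_def sym_op_square sym_opD[symmetric, of A _ "A _"])

lemma psd_op_add: "psd_op A \<Longrightarrow> psd_op B \<Longrightarrow> psd_op (A + B)"
  by (simp add: psd_op_def sym_op_add blinfun.add_left rip_simps)

lemma psd_op_scaleR: "0 \<le> r \<Longrightarrow> psd_op A \<Longrightarrow> psd_op (r *\<^sub>R A)"
  by (simp add: psd_op_def sym_op_scaleR blinfun.scaleR_left rip_simps)

lemma sym_op_limit:
  assumes "F \<longlonglongrightarrow> A" "\<And>n. sym_op (F n)"
  shows "sym_op A"
  unfolding sym_op_def
proof (intro allI)
  fix x y
  have "(\<lambda>n. rip (F n x) y) \<longlonglongrightarrow> rip (A x) y" "(\<lambda>n. rip x (F n y)) \<longlonglongrightarrow> rip x (A y)"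
    using assms(1) by (intro bounded_bilinear.tendsto[OF bounded_bilinear_rip]
        bounded_bilinear.tendsto[OF bounded_bilinear_blinfun_apply] tendsto_const; assumption)+
  moreover have "(\<lambda>n. rip (F n x) y) = (\<lambda>n. rip x (F n y))"
    using assms(2) by (simp add: sym_op_def)
  ultimately show "rip (A x) y = rip x (A y)" by (metis LIMSEQ_unique)
qed

section \<open>Square roots by a norm-convergent iteration\<close>

lemma blinfun_eq_iff: "A = B \<longleftrightarrow> (\<forall>x. blinfun_apply A x = blinfun_apply B x)"
  using blinfun_eqI by blast

text \<open>The fixed points \<open>Y = (B + Y\<^sup>2)/2\<close> are those with \<open>(1 - Y)\<^sup>2 = 1 - B\<close>.\<close>

fun root_num :: "nat \<Rightarrow> real" where
  "root_num 0 = 0"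
| "root_num (Suc n) = (1 + (root_num n)\<^sup>2) / 2"

fun root_iter :: "('a :: real_normed_vector \<Rightarrow>\<^sub>L 'a) \<Rightarrow> nat \<Rightarrow> ('a \<Rightarrow>\<^sub>L 'a)" where
  "root_iter B 0 = 0"
| "root_iter B (Suc n) = (1/2) *\<^sub>R (B + (root_iter B n o\<^sub>L root_iter B n))"

lemma root_num_bounds: "0 \<le> root_num n \<and> root_num n \<le> 1"
proof (induction n)
  case (Suc n)
  then have "(root_num n)\<^sup>2 \<le> 1" by (simp add: power_le_one)
  then show ?case by simp
qed simp

lemma root_num_incseq: "incseq root_num"
proof (rule incseq_SucI)
  fix n show "root_num n \<le> root_num (Suc n)"
    using zero_le_power2[of "root_num n - 1"] by (simp add: power2_eq_square algebra_simps)
qed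

lemma root_iter_norm:
  assumes "norm B \<le> 1"
  shows "norm (root_iter B n) \<le> root_num n"
proof (induction n)
  case (Suc n)
  have "norm (root_iter B n o\<^sub>L root_iter B n) \<le> root_num n * root_num n"
    using norm_blinfun_compose[of "root_iter B n" "root_iter B n"] Suc
    by (smt (verit, best) mult_mono norm_ge_zero)
  then show ?case
    using norm_triangle_ineq[of B "root_iter B n o\<^sub>L root_iter B n"] assms
    by (simp add: power2_eq_square)
qed simp

text \<open>\<open>root_num\<close> is the iteration for \<open>B = 1\<close>; its increments majorise those of the operator iteration,
  so the latter converges in norm.\<close>

lemma root_iter_step:
  assumes "norm B \<le> 1"
  shows "norm (root_iter B (Suc n) - root_iter B n) \<le> root_num (Suc n) - root_num n"
proof (induction n)
  case 0
  then show ?case using assms by simp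
next
  case (Suc n)
  let ?Y = "root_iter B n" and ?Y' = "root_iter B (Suc n)"
  have "root_iter B (Suc (Suc n)) - ?Y' = (1/2) *\<^sub>R ((?Y' o\<^sub>L (?Y' - ?Y)) + ((?Y' - ?Y) o\<^sub>L ?Y))"
  proof -
    have "root_iter B (Suc (Suc n)) - ?Y' = (1/2) *\<^sub>R (B + (?Y' o\<^sub>L ?Y')) - (1/2) *\<^sub>R (B + (?Y o\<^sub>L ?Y))"
      by (simp del: root_iter.simps add: root_iter.simps(2)[of B "Suc n"] root_iter.simps(2)[of B n, symmetric])
    then show ?thesis
      by (simp del: root_iter.simps add: blinfun_eq_iff blinfun.bilinear_simps algebra_simps)
  qed
  also have "norm \<dots> \<le> (1/2) * (norm (?Y' o\<^sub>L (?Y' - ?Y)) + norm ((?Y' - ?Y) o\<^sub>L ?Y))"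
    by (simp del: root_iter.simps add: norm_triangle_ineq)
  also have "\<dots> \<le> (1/2) * (root_num (Suc n) * (root_num (Suc n) - root_num n)
      + (root_num (Suc n) - root_num n) * root_num n)"
    using Suc root_iter_norm[OF assms, of n] root_iter_norm[OF assms, of "Suc n"] root_num_bounds
      incseqD[OF root_num_incseq, of n "Suc n"]
    by (intro mult_left_mono add_mono order_trans[OF norm_blinfun_compose] mult_mono)
       (auto simp del: root_iter.simps root_num.simps)
  also have "\<dots> = root_num (Suc (Suc n)) - root_num (Suc n)"
    by (simp add: power2_eq_square field_simps)
  finally show ?case .
qed

lemma root_iter_convergent:
  fixes B :: "'a :: banach \<Rightarrow>\<^sub>L 'a"
  assumes B: "norm B \<le> 1"
  shows "convergent (root_iter B)"
proof -
  have diff: "norm (root_iter B (n + k) - root_iter B n) \<le> root_num (n + k) - root_num n" for n k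
  proof (induction k)
    case (Suc k)
    have "norm (root_iter B (Suc (n + k)) - root_iter B n)
        \<le> norm (root_iter B (Suc (n + k)) - root_iter B (n + k)) + norm (root_iter B (n + k) - root_iter B n)"
      by (rule norm_diff_triangle_le) auto
    then show ?case using Suc root_iter_step[OF B, of "n + k"] by simp
  qed simp
  have "convergent root_num"
    using root_num_bounds by (intro Bseq_mono_convergent BseqI[of 1])
      (auto simp: incseqD[OF root_num_incseq])
  then have "Cauchy root_num" by (rule convergent_Cauchy)
  have "Cauchy (root_iter B)"
  proof (rule metric_CauchyI)
    fix e :: real assume "0 < e"
    then obtain M where M: "\<And>m n. m \<ge> M \<Longrightarrow> n \<ge> M \<Longrightarrow> dist (root_num m) (root_num n) < e"
      using \<open>Cauchy root_num\<close> metric_CauchyD by blast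
    have *: "dist (root_iter B m) (root_iter B n) < e" if "m \<ge> n" "n \<ge> M" for m n
    proof -
      have "dist (root_iter B m) (root_iter B n) \<le> root_num m - root_num n"
        using diff[of n "m - n"] that by (simp add: dist_norm)
      also have "\<dots> \<le> dist (root_num m) (root_num n)" by (simp add: dist_real_def)
      also have "\<dots> < e" using that by (intro M) auto
      finally show ?thesis .
    qed
    show "\<exists>M. \<forall>m\<ge>M. \<forall>n\<ge>M. dist (root_iter B m) (root_iter B n) < e"
    proof (intro exI[of _ M] allI impI)
      fix m n assume "m \<ge> M" "n \<ge> M"
      then show "dist (root_iter B m) (root_iter B n) < e"
        using *[of n m] *[of m n] by (cases "m \<le> n") (auto simp: dist_commute)
    qed
  qed
  then show ?thesis by (simp add: Cauchy_convergent)
qed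

lemma compose_limit:
  assumes "F \<longlonglongrightarrow> A"
  shows "(\<lambda>n. F n o\<^sub>L B) \<longlonglongrightarrow> (A o\<^sub>L B)" "(\<lambda>n. B o\<^sub>L F n) \<longlonglongrightarrow> (B o\<^sub>L A)"
    "(\<lambda>n. F n o\<^sub>L F n) \<longlonglongrightarrow> (A o\<^sub>L A)"
  using assms by (auto intro!: bounded_bilinear.tendsto[OF bounded_bilinear_blinfun_compose])

text \<open>The root is \<open>1 - Y\<close> for the limit \<open>Y\<close> of the iteration with
  \<open>B = 1 - A\<close>; it is positive because \<open>norm Y \<le> 1\<close>. Each iterate is a
  polynomial in \<open>B\<close>, so the root commutes with every real-linear \<open>C\<close> that
  commutes with \<open>A\<close>, a generality later exploited for complex scalars.\<close>

lemma psd_sqrt_exists_unit: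
  fixes A :: "'h :: complex_hilbert \<Rightarrow>\<^sub>L 'h"
  assumes A: "psd_op A" and le: "\<And>x. rip x (A x) \<le> (norm x)\<^sup>2"
  shows "\<exists>R. psd_op R \<and> R o\<^sub>L R = A \<and> (\<forall>C. A o\<^sub>L C = C o\<^sub>L A \<longrightarrow> R o\<^sub>L C = C o\<^sub>L R)"
proof -
  define B where "B = id_blinfun - A"
  have B: "psd_op B"
    using psd_opD[OF A] le by (simp add: B_def psd_op_def sym_op_diff sym_op_id blinfun.diff_left rip_simps rip_self)
  have nB: "norm B \<le> 1"
    using psd_opD[OF A] by (intro psd_op_norm_le[OF B]) (simp add: B_def blinfun.diff_left rip_simps rip_self)
  obtain Y where Y: "root_iter B \<longlonglongrightarrow> Y"
    using root_iter_convergent[OF nB] by (auto simp: convergent_def)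
  have "sym_op (root_iter B n)" for n
  proof (induction n)
    case 0 then show ?case by (simp add: sym_op_def)
  next
    case (Suc n) then show ?case
      by (simp add: sym_op_scaleR sym_op_add sym_op_square psd_opD[OF B])
  qed
  then have symY: "sym_op Y" by (rule sym_op_limit[OF Y])
  have nY: "norm Y \<le> 1"
    using Y root_iter_norm[OF nB] root_num_bounds
    by (intro LIMSEQ_le_const2[OF tendsto_norm[OF Y]]) (meson order_trans)
  have comm: "Y o\<^sub>L C = C o\<^sub>L Y" if C: "A o\<^sub>L C = C o\<^sub>L A" for C
  proof -
    have BC: "B (C x) = C (B x)" for x
      using C by (simp add: B_def blinfun_eq_iff blinfun.bilinear_simps)
    have "root_iter B n (C x) = C (root_iter B n x)" for n x
      by (induction n arbitrary: x) (simp_all add: blinfun.bilinear_simps BC)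
    then have "root_iter B n o\<^sub>L C = C o\<^sub>L root_iter B n" for n by (simp add: blinfun_eq_iff)
    then show ?thesis using compose_limit(1)[OF Y, of C] compose_limit(2)[OF Y, of C]
      by (simp add: LIMSEQ_unique)
  qed
  have fix_eq: "Y = (1/2) *\<^sub>R (B + (Y o\<^sub>L Y))"
  proof (rule LIMSEQ_unique)
    show "(\<lambda>n. root_iter B (Suc n)) \<longlonglongrightarrow> Y" using Y by (rule LIMSEQ_Suc)
    show "(\<lambda>n. root_iter B (Suc n)) \<longlonglongrightarrow> (1/2) *\<^sub>R (B + (Y o\<^sub>L Y))"
      unfolding root_iter.simps by (intro tendsto_intros compose_limit(3) Y)
  qed
  define R where "R = id_blinfun - Y"
  have "psd_op R"
  proof -
    have "rip x (Y x) \<le> (norm x)\<^sup>2" for x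
    proof -
      have "norm (Y x) \<le> norm x" using norm_blinfun[of Y x] mult_right_mono[OF nY norm_ge_zero[of x]] by simp
      then show ?thesis
        using rip_bound[of x "Y x"] mult_left_mono[of "norm (Y x)" "norm x" "norm x"] by (simp add: power2_eq_square)
    qed
    then show ?thesis
      by (simp add: R_def psd_op_def sym_op_diff sym_op_id symY blinfun.diff_left rip_simps rip_self)
  qed
  moreover have "R o\<^sub>L R = A"
  proof -
    have YY: "2 *\<^sub>R Y x = B x + Y (Y x)" for x
    proof -
      have "Y x = (1/2) *\<^sub>R (B x + Y (Y x))"
        by (subst (1) fix_eq) (simp add: blinfun.bilinear_simps)
      then have "2 *\<^sub>R Y x = 2 *\<^sub>R ((1/2) *\<^sub>R (B x + Y (Y x)))" by (rule arg_cong)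
      also have "\<dots> = B x + Y (Y x)" by simp
      finally show ?thesis .
    qed
    show ?thesis
    proof (rule blinfun_eqI)
      fix x
      have "R (R x) = x - 2 *\<^sub>R Y x + Y (Y x)" by (simp add: R_def blinfun.bilinear_simps scaleR_2)
      also have "\<dots> = A x" by (simp add: YY B_def blinfun.diff_left)
      finally show "(R o\<^sub>L R) x = A x" by simp
    qed
  qed
  moreover have "R o\<^sub>L C = C o\<^sub>L R" if "A o\<^sub>L C = C o\<^sub>L A" for C
    using comm[OF that] by (simp add: R_def blinfun_eq_iff blinfun.bilinear_simps)
  ultimately show ?thesis by blast
qed

lemma psd_sqrt_exists:
  fixes A :: "'h :: complex_hilbert \<Rightarrow>\<^sub>L 'h"
  assumes A: "psd_op A"
  obtains R where "psd_op R" "R o\<^sub>L R = A" "\<And>C. A o\<^sub>L C = C o\<^sub>L A \<Longrightarrow> R o\<^sub>L C = C o\<^sub>L R"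
proof -
  \<comment> \<open>Rescaling by \<open>K\<close> brings the form below 1; the summand 1 covers
    \<open>A = 0\<close>.\<close>
  define K where "K = norm A + 1"
  have K: "K > 0" by (simp add: K_def add_nonneg_pos)
  have "rip x ((inverse K *\<^sub>R A) x) \<le> (norm x)\<^sup>2" for x
  proof -
    have "rip x (A x) \<le> norm x * norm (A x)" using rip_bound[of x "A x"] by simp
    also have "\<dots> \<le> norm x * (norm A * norm x)" by (intro mult_left_mono norm_blinfun) simp
    also have "\<dots> \<le> K * (norm x)\<^sup>2" by (simp add: K_def power2_eq_square algebra_simps)
    finally show ?thesis using K by (simp add: blinfun.scaleR_left rip_simps field_simps)
  qed
  moreover have "psd_op (inverse K *\<^sub>R A)" using A K by (simp add: psd_op_scaleR)
  ultimately obtain R where R: "psd_op R" "R o\<^sub>L R = inverse K *\<^sub>R A"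
    "\<And>C. (inverse K *\<^sub>R A) o\<^sub>L C = C o\<^sub>L (inverse K *\<^sub>R A) \<Longrightarrow> R o\<^sub>L C = C o\<^sub>L R"
    using psd_sqrt_exists_unit[of "inverse K *\<^sub>R A"] by blast
  have RR: "R (R x) = inverse K *\<^sub>R A x" for x
    using R(2) by (metis blinfun.scaleR_left blinfun_apply_blinfun_compose)
  show ?thesis
  proof (rule that[of "sqrt K *\<^sub>R R"])
    show "psd_op (sqrt K *\<^sub>R R)" using R(1) K by (simp add: psd_op_scaleR)
    show "(sqrt K *\<^sub>R R) o\<^sub>L (sqrt K *\<^sub>R R) = A"
    proof (rule blinfun_eqI)
      fix x
      have "((sqrt K *\<^sub>R R) o\<^sub>L (sqrt K *\<^sub>R R)) x = (sqrt K * sqrt K) *\<^sub>R R (R x)"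
        by (simp only: blinfun_apply_blinfun_compose blinfun.scaleR_left blinfun.scaleR_right scaleR_scaleR)
      also have "\<dots> = A x" using K by (simp add: RR)
      finally show "((sqrt K *\<^sub>R R) o\<^sub>L (sqrt K *\<^sub>R R)) x = A x" .
    qed
    show "(sqrt K *\<^sub>R R) o\<^sub>L C = C o\<^sub>L (sqrt K *\<^sub>R R)" if "A o\<^sub>L C = C o\<^sub>L A" for C
      using R(3)[of C] that by (simp add: blinfun_eq_iff blinfun.bilinear_simps)
  qed
qed

text \<open>For \<open>D = P - R\<close> commutation gives \<open>(P + R) D = 0\<close>. Both forms
  are nonnegative, so each vanishes at \<open>D x\<close>; hence \<open>P D = R D = 0\<close>, and
  the symmetric \<open>D\<close> has square 0.\<close>

lemma psd_sqrt_unique: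
  fixes A :: "'h :: complex_hilbert \<Rightarrow>\<^sub>L 'h"
  assumes P: "psd_op P" and R: "psd_op R" and eq: "P o\<^sub>L P = R o\<^sub>L R" and comm: "P o\<^sub>L R = R o\<^sub>L P"
  shows "P = R"
proof (rule blinfun_eqI)
  fix x
  define D where "D = P - R"
  have PP: "P (P y) = R (R y)" and PR: "P (R y) = R (P y)" for y
    using eq comm by (metis blinfun_apply_blinfun_compose)+
  have zero: "P (D x) + R (D x) = 0"
    by (simp add: D_def blinfun.bilinear_simps PP PR)
  have "rip (D x) (P (D x)) + rip (D x) (R (D x)) = 0"
    using zero by (simp flip: rip_add_right)
  then have "rip (D x) (P (D x)) = 0" "rip (D x) (R (D x)) = 0"
    using psd_opD(2)[OF P, of "D x"] psd_opD(2)[OF R, of "D x"] by auto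
  then have "P (D x) = 0" "R (D x) = 0" using psd_op_kernel P R by blast+
  then have "D (D x) = 0" by (simp add: D_def blinfun.diff_left)
  moreover have "rip (D x) (D x) = rip x (D (D x))"
    using P R by (intro sym_opD) (simp add: D_def sym_op_diff psd_opD)
  ultimately have "D x = 0" by (simp add: rip_self)
  then show "P x = R x" by (simp add: D_def blinfun.diff_left)
qed

section \<open>Domination of a symmetric operator by its modulus\<close>

text \<open>A Lax-Milgram argument: since the form of \<open>G = R + e\<close> is at least
  \<open>e\<close>, the map \<open>w - c (G w - x)\<close> is a contraction in \<open>w\<close> for
  small \<open>c\<close>, and its fixed point solves the equation.\<close>

lemma strictly_psd_surj:
  fixes R :: "'h :: complex_hilbert \<Rightarrow>\<^sub>L 'h"
  assumes R: "psd_op R" and e: "0 < e"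
  shows "\<exists>w. R w + e *\<^sub>R w = x"
proof -
  define G where "G = R + e *\<^sub>R id_blinfun"
  define K where "K = norm G + e"
  \<comment> \<open>This value minimises the bound \<open>1 - 2 * c * e + c^2 * K^2\<close> for the
    squared contraction factor; the minimum is \<open>q^2\<close>.\<close>
  define c where "c = e / K\<^sup>2"
  define q where "q = sqrt (1 - (e / K)\<^sup>2)"
  have K: "e \<le> K" "0 < K" "norm G \<le> K" using e by (auto simp: K_def add_nonneg_pos)
  have c: "0 < c" using e K by (simp add: c_def)
  have eK: "(e / K)\<^sup>2 \<le> 1" using e K by (simp add: power_le_one)
  have contr: "norm (u - c *\<^sub>R G u) \<le> q * norm u" for u
  proof (rule power2_le_imp_le)
    have G1: "e * (norm u)\<^sup>2 \<le> rip u (G u)"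
      using psd_opD(2)[OF R, of u] by (simp add: G_def blinfun.bilinear_simps rip_simps rip_self)
    have "norm (G u) \<le> K * norm u"
      using norm_blinfun[of G u] mult_right_mono[OF K(3) norm_ge_zero[of u]] by linarith
    then have G2: "(norm (G u))\<^sup>2 \<le> K\<^sup>2 * (norm u)\<^sup>2"
      by (metis norm_ge_zero power_mono power_mult_distrib)
    have "(norm (u - c *\<^sub>R G u))\<^sup>2 = (norm u)\<^sup>2 - 2 * c * rip u (G u) + c\<^sup>2 * (norm (G u))\<^sup>2"
      unfolding rip_self[symmetric]
      by (simp add: rip_simps rip_commute[of "G u" u] power2_eq_square algebra_simps)
    also have "\<dots> \<le> (norm u)\<^sup>2 - 2 * c * (e * (norm u)\<^sup>2) + c\<^sup>2 * (K\<^sup>2 * (norm u)\<^sup>2)"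
      using c by (intro add_mono diff_mono mult_left_mono G1 G2) auto
    also have "\<dots> = (1 - (e / K)\<^sup>2) * (norm u)\<^sup>2"
      using K by (simp add: c_def field_simps power2_eq_square)
    also have "\<dots> = (q * norm u)\<^sup>2" using eK by (simp add: q_def power_mult_distrib)
    finally show "(norm (u - c *\<^sub>R G u))\<^sup>2 \<le> (q * norm u)\<^sup>2" .
  qed (use eK in \<open>simp add: q_def\<close>)
  have "\<exists>!w. w - c *\<^sub>R (G w - x) = w"
  proof (rule banach_fix_type[where c = q])
    show "0 \<le> q" using eK by (simp add: q_def)
    show "q < 1" using e K by (simp add: q_def)
    show "\<forall>v w. dist (v - c *\<^sub>R (G v - x)) (w - c *\<^sub>R (G w - x)) \<le> q * dist v w"
    proof (intro allI)
      fix v w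
      have "(v - c *\<^sub>R (G v - x)) - (w - c *\<^sub>R (G w - x)) = (v - w) - c *\<^sub>R G (v - w)"
        by (simp add: blinfun.diff_right scaleR_diff_right)
      then show "dist (v - c *\<^sub>R (G v - x)) (w - c *\<^sub>R (G w - x)) \<le> q * dist v w"
        by (simp only: dist_norm contr)
    qed
  qed
  then obtain w where "w - c *\<^sub>R (G w - x) = w" by blast
  then have "G w = x" using c by simp
  then show ?thesis by (auto simp: G_def blinfun.bilinear_simps)
qed

text \<open>Without a polar decomposition: \<open>G = R + e\<close> is onto and dominates \<open>s\<close> in the sense that
  \<open>G s\<^sup>2 \<le> G\<^sup>3\<close>. Writing \<open>x = G w\<close>, the Cauchy-Schwarz inequality for the form of \<open>G\<close> gives
  \<open>\<langle>x, s x\<rangle> = \<langle>G w, G s w\<rangle> \<le> \<langle>x, G x\<rangle>\<close>; let \<open>e \<rightarrow> 0\<close>.\<close>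

lemma rip_le_abs:
  fixes s R :: "'h :: complex_hilbert \<Rightarrow>\<^sub>L 'h"
  assumes s: "sym_op s" and R: "psd_op R" and RR: "R o\<^sub>L R = s o\<^sub>L s" and comm: "R o\<^sub>L s = s o\<^sub>L R"
  shows "\<bar>rip x (s x)\<bar> \<le> rip x (R x)"
proof (rule field_le_epsilon)
  have Rs: "R (s y) = s (R y)" and ss: "s (s y) = R (R y)" for y
    using comm RR by (metis blinfun_apply_blinfun_compose)+
  have symR: "rip (R u) v = rip u (R v)" for u v using R by (intro sym_opD psd_opD)
  have weak: "\<bar>rip x (s x)\<bar> \<le> rip x (R x) + e * (norm x)\<^sup>2" if e: "0 < e" for e
  proof -
    define G where "G = R + e *\<^sub>R id_blinfun"
    have G: "psd_op G" using R e by (simp add: G_def psd_op_add psd_op_scaleR psd_op_id)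
    obtain w where w: "x = G w"
      using strictly_psd_surj[OF R e, of x] by (auto simp: G_def blinfun.bilinear_simps)
    have Gs: "G (s y) = s (G y)" for y by (simp add: G_def blinfun.bilinear_simps Rs)
    have "rip (s w) (G (s w)) = rip w (G (R (R w)))"
      by (simp add: sym_opD[OF s] Gs[symmetric] ss)
    also have "\<dots> \<le> rip x (G x)"
    proof -
      have eq: "rip x (G x) = rip w (G (G (G w)))"
        unfolding w by (simp add: sym_opD[OF psd_opD(1)[OF G]])
      \<comment> \<open>Expansion of \<open>(R + e)^3 - (R + e) R^2\<close>; every term on the right
        has a nonnegative form.\<close>
      have "G (G (G w)) - G (R (R w)) = (2 * e) *\<^sub>R R (R w) + (3 * e\<^sup>2) *\<^sub>R R w + e^3 *\<^sub>R w"
      proof -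
        have two: "(2 * e) *\<^sub>R v = e *\<^sub>R v + e *\<^sub>R v"
          and three: "(3 * (e * e)) *\<^sub>R v = (e * e) *\<^sub>R v + (e * e) *\<^sub>R v + (e * e) *\<^sub>R v" for v :: 'h
          by (simp_all flip: scaleR_add_left)
        show ?thesis
          by (simp add: G_def blinfun.bilinear_simps scaleR_add_right two three power2_eq_square power3_eq_cube)
      qed
      then have "rip w (G (G (G w))) - rip w (G (R (R w)))
          = 2 * e * rip w (R (R w)) + 3 * e\<^sup>2 * rip w (R w) + e^3 * rip w w"
        by (metis rip_add_right rip_diff_right rip_scaleR_right)
      moreover have "0 \<le> rip w (R (R w))" by (metis rip_nonneg symR)
      moreover have "0 \<le> rip w (R w)" using R by (rule psd_opD)
      ultimately show ?thesis using e by (simp add: eq)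
        (smt (verit) mult_nonneg_nonneg rip_nonneg zero_le_power power2_eq_square)
    qed
    finally have le: "rip (s w) (G (s w)) \<le> rip x (G x)" .
    have "rip x (s x) = rip x (G (s w))" by (simp add: w Gs)
    then have "(rip x (s x))\<^sup>2 \<le> rip x (G x) * rip (s w) (G (s w))"
      using psd_cauchy_schwarz[OF G] by simp
    also have "\<dots> \<le> rip x (G x) * rip x (G x)"
      using le psd_opD(2)[OF G] by (intro mult_left_mono) auto
    finally have "\<bar>rip x (s x)\<bar> \<le> rip x (G x)"
      using psd_opD(2)[OF G, of x] by (simp add: power2_eq_square abs_le_square_iff[symmetric] flip: power2_eq_square)
    then show ?thesis by (simp add: G_def blinfun.bilinear_simps rip_simps rip_self)
  qed
  fix d :: real assume d: "0 < d"
  have n: "0 < (norm x)\<^sup>2 + 1" by (simp add: add_nonneg_pos)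
  have "d / ((norm x)\<^sup>2 + 1) * (norm x)\<^sup>2 \<le> d" using n d by (simp add: field_simps)
  then show "\<bar>rip x (s x)\<bar> \<le> rip x (R x) + d"
    using weak[of "d / ((norm x)\<^sup>2 + 1)"] d n by simp
qed

section \<open>The cone of integrable operators\<close>

lemma Im_cinner: "Im (cinner x y) = - rip x (\<i> *\<^sub>C y)"
  by (simp add: rip_def cinner_scaleC_right)

lemma is_adjoint_unique:
  assumes "is_adjoint A B" "is_adjoint A C"
  shows "B = C"
proof (rule blinfun_eqI)
  fix x
  have "cinner y (B x) = cinner y (C x)" for y
    using assms unfolding is_adjoint_def by metis
  then show "B x = C x" by (intro eq_from_rip) (simp add: rip_def)
qed

lemma adj_eq: "is_adjoint A B \<Longrightarrow> adj A = B"
  unfolding adj_def using is_adjoint_unique by blast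

lemma is_adjoint_rip: "is_adjoint A B \<Longrightarrow> rip (A x) y = rip x (B y)"
  by (simp add: is_adjoint_def rip_def)

lemma sym_op_is_adjoint: "is_adjoint A A \<Longrightarrow> sym_op A"
  by (simp add: sym_op_def is_adjoint_rip)

text \<open>The imaginary part of the inner product is, up to sign, a real part at
  \<open>\<i> y\<close>; complex linearity thus extends symmetry from the real form to the complex
  one.\<close>

lemma is_adjoint_self:
  assumes "sym_op A" "A \<in> bounded_ops"
  shows "is_adjoint A A"
  unfolding is_adjoint_def
proof (intro allI complex_eqI)
  fix x y
  show "Re (cinner (A x) y) = Re (cinner x (A y))"
    using sym_opD[OF assms(1)] by (simp add: rip_def)
  have "A (\<i> *\<^sub>C y) = \<i> *\<^sub>C A y" using assms(2) by (simp add: bounded_ops_def)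
  then show "Im (cinner (A x) y) = Im (cinner x (A y))"
    using sym_opD[OF assms(1), of x "\<i> *\<^sub>C y"] by (simp add: Im_cinner)
qed

text \<open>Polarisation: reality of the form at \<open>x + \<i> y\<close> compares the mixed terms
  and yields the symmetry that \<open>psd_op\<close> demands.\<close>

lemma positive_op_iff: "positive_op A \<longleftrightarrow> A \<in> bounded_ops \<and> psd_op A"
proof
  assume A: "positive_op A"
  then have lin: "A (c *\<^sub>C x) = c *\<^sub>C A x" for c x by (simp add: positive_op_def bounded_ops_def)
  have real: "Im (cinner x (A x)) = 0" for x
    using A by (simp add: positive_op_def complex_is_Real_iff)
  have "rip (A x) y = rip x (A y)" for x y
  proof -
    let ?y = "\<i> *\<^sub>C y"
    have l: "cinner (u + v) w = cinner u w + cinner v w" for u v w :: 'a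
      by (metis cinner_add_right cinner_commute complex_cnj_add)
    have "Im (cinner (x + ?y) (A (x + ?y))) = 0" by (rule real)
    then have "Im (cinner x (A ?y)) + Im (cinner ?y (A x)) = 0"
      using real[of x] real[of ?y] by (simp add: blinfun.add_right l cinner_add_right)
    moreover have "Im (cinner x (A ?y)) = rip x (A y)"
      by (simp add: lin cinner_scaleC_right rip_def)
    moreover have "Im (cinner ?y (A x)) = - rip (A x) y"
      by (subst cinner_commute) (simp add: cinner_scaleC_right rip_def)
    ultimately show ?thesis by simp
  qed
  then show "A \<in> bounded_ops \<and> psd_op A"
    using A by (simp add: psd_op_def sym_op_def positive_op_def rip_def)
next
  assume A: "A \<in> bounded_ops \<and> psd_op A"
  have "cinner x (A x) \<in> \<real>" for x
  proof -
    have "cinner x (A x) = cnj (cinner x (A x))"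
      using is_adjoint_self[of A] A psd_opD(1) by (metis cinner_commute is_adjoint_def)
    then show ?thesis by (metis Reals_cnj_iff)
  qed
  then show "positive_op A" using A psd_opD(2)[of A] by (simp add: positive_op_def rip_def)
qed

lemma bounded_ops_add: "A \<in> bounded_ops \<Longrightarrow> B \<in> bounded_ops \<Longrightarrow> A + B \<in> bounded_ops"
  and bounded_ops_scaleC: "A \<in> bounded_ops \<Longrightarrow> c *\<^sub>C A \<in> bounded_ops"
  by (auto simp: bounded_ops_def blinfun.add_left scaleC_add_right scaleC_blinfun_apply scaleC_scaleC mult.commute)

lemma blinfun_scaleC_right: "B \<in> bounded_ops \<Longrightarrow> blinfun_apply B (c *\<^sub>C x) = c *\<^sub>C blinfun_apply B x"
  by (simp add: bounded_ops_def)

lemma commutant_add: "A \<in> commutant N \<Longrightarrow> B \<in> commutant N \<Longrightarrow> A + B \<in> commutant N"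
  by (auto simp: commutant_def bounded_ops_add blinfun_eq_iff blinfun.bilinear_simps)

lemma commutant_scaleC:
  assumes "A \<in> commutant N" "N \<subseteq> bounded_ops"
  shows "c *\<^sub>C A \<in> commutant N"
  using assms
  by (auto simp: commutant_def bounded_ops_scaleC blinfun_eq_iff scaleC_blinfun_apply blinfun_scaleC_right subset_eq)

locale traced_vn_algebra =
  fixes M :: "('h :: complex_hilbert \<Rightarrow>\<^sub>L 'h) set"
    and \<tau> :: "('h \<Rightarrow>\<^sub>L 'h) \<Rightarrow> ennreal"
    and \<iota> :: "('h \<Rightarrow>\<^sub>L 'h) \<Rightarrow> 'l :: complex_banach"
  assumes vn: "von_neumann_algebra M" and trace: "trace_on M \<tau>" and L1: "is_L1 M \<tau> \<iota>"
begin

lemma M_bounded: "A \<in> M \<Longrightarrow> A \<in> bounded_ops"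
  and bicommutant: "commutant (commutant M) = M"
  and M_adjoint: "A \<in> M \<Longrightarrow> \<exists>B\<in>M. is_adjoint A B"
  using vn by (auto simp: von_neumann_algebra_def)

lemma commutant_bounded: "commutant N \<subseteq> bounded_ops"
  by (auto simp: commutant_def)

text \<open>Closure under the linear operations is not among the defining conditions; it is
  inherited from the double commutant.\<close>

lemma M_add: "A \<in> M \<Longrightarrow> B \<in> M \<Longrightarrow> A + B \<in> M"
  using commutant_add[of A "commutant M" B] by (simp add: bicommutant)

lemma M_scaleC: "A \<in> M \<Longrightarrow> c *\<^sub>C A \<in> M"
  using commutant_scaleC[OF _ commutant_bounded, of A M c] by (simp add: bicommutant)

lemma M_scaleR: "A \<in> M \<Longrightarrow> r *\<^sub>R A \<in> M"
  by (simp add: scaleR_scaleC M_scaleC)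

lemma M_diff: "A \<in> M \<Longrightarrow> B \<in> M \<Longrightarrow> A - B \<in> M"
  using M_add[OF _ M_scaleR[of B "-1"], of A] by simp

lemma vn_pos_iff: "A \<in> vn_pos M \<longleftrightarrow> A \<in> M \<and> psd_op A"
  using M_bounded by (auto simp: vn_pos_def positive_op_iff)

text \<open>\<open>adj\<close> is a definite description; the adjoint that \<open>M\<close> supplies
  turns \<open>adj A = A\<close> into a statement about an actual adjoint.\<close>

lemma vn_sa_iff: "A \<in> vn_sa M \<longleftrightarrow> A \<in> M \<and> sym_op A"
proof
  assume A: "A \<in> vn_sa M"
  then obtain B where "is_adjoint A B" using M_adjoint by (auto simp: vn_sa_def)
  then show "A \<in> M \<and> sym_op A" using A adj_eq sym_op_is_adjoint by (fastforce simp: vn_sa_def)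
next
  assume A: "A \<in> M \<and> sym_op A"
  then show "A \<in> vn_sa M" using adj_eq[OF is_adjoint_self[of A]] M_bounded by (simp add: vn_sa_def)
qed

lemma adj_sa: "A \<in> vn_sa M \<Longrightarrow> adj A = A"
  by (simp add: vn_sa_def)

lemma pos_sa: "A \<in> vn_pos M \<Longrightarrow> A \<in> vn_sa M"
  by (simp add: vn_pos_iff vn_sa_iff psd_opD)

lemma vn_sa_add: "A \<in> vn_sa M \<Longrightarrow> B \<in> vn_sa M \<Longrightarrow> A + B \<in> vn_sa M"
  and vn_sa_diff: "A \<in> vn_sa M \<Longrightarrow> B \<in> vn_sa M \<Longrightarrow> A - B \<in> vn_sa M"
  and vn_sa_scaleR: "A \<in> vn_sa M \<Longrightarrow> r *\<^sub>R A \<in> vn_sa M"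
  and vn_pos_add: "A \<in> vn_pos M \<Longrightarrow> B \<in> vn_pos M \<Longrightarrow> A + B \<in> vn_pos M"
  and vn_pos_scaleR: "0 \<le> r \<Longrightarrow> A \<in> vn_pos M \<Longrightarrow> r *\<^sub>R A \<in> vn_pos M"
  by (simp_all add: vn_sa_iff vn_pos_iff M_add M_diff M_scaleR sym_op_add sym_op_diff sym_op_scaleR
      psd_op_add psd_op_scaleR)

section \<open>Modulus and Jordan parts inside the algebra\<close>

text \<open>\<open>abs_op\<close> is a definite description, so uniqueness is the point: a positive
  root \<open>Q\<close> of \<open>s^2\<close> commutes with \<open>s^2 = Q^2\<close>, hence with the
  constructed root \<open>R\<close>, and commuting positive roots agree.\<close>

lemma abs_op_eqI:
  assumes s: "s \<in> vn_sa M" and P: "psd_op P" "P \<in> bounded_ops" "P o\<^sub>L P = s o\<^sub>L s"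
  shows "abs_op s = P"
  unfolding abs_op_def
proof (rule the_equality)
  show "positive_op P \<and> P o\<^sub>L P = adj s o\<^sub>L s" using P adj_sa[OF s] by (simp add: positive_op_iff)
  have "psd_op (s o\<^sub>L s)" using s by (simp add: vn_sa_iff psd_op_square)
  then obtain R where R: "psd_op R" "R o\<^sub>L R = s o\<^sub>L s"
    and comm: "\<And>C. (s o\<^sub>L s) o\<^sub>L C = C o\<^sub>L (s o\<^sub>L s) \<Longrightarrow> R o\<^sub>L C = C o\<^sub>L R"
    using psd_sqrt_exists by blast
  have unique: "Q = R" if Q: "psd_op Q" "Q o\<^sub>L Q = s o\<^sub>L s" for Q
  proof (rule psd_sqrt_unique[OF Q(1) R(1)])
    have "(s o\<^sub>L s) o\<^sub>L Q = Q o\<^sub>L (s o\<^sub>L s)"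
      unfolding Q(2)[symmetric] by (rule blinfun_eqI) simp
    then show "Q o\<^sub>L R = R o\<^sub>L Q" using comm by simp
  qed (use Q R in simp)
  fix Q assume "positive_op Q \<and> Q o\<^sub>L Q = adj s o\<^sub>L s"
  then show "Q = P" using unique[of P] unique[of Q] P adj_sa[OF s] by (simp add: positive_op_iff)
qed

text \<open>The root of \<open>s^2\<close> commutes with all that commutes with \<open>s\<close>.
  Scalar multiplication, taken as a real-linear operator, gives complex linearity of the root; the
  elements of the commutant give its membership in \<open>M\<close>.\<close>

lemma abs_op_sa:
  assumes s: "s \<in> vn_sa M"
  shows "abs_op s \<in> vn_pos M" and "abs_op s o\<^sub>L abs_op s = s o\<^sub>L s" and "abs_op s o\<^sub>L s = s o\<^sub>L abs_op s"
proof -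
  have "psd_op (s o\<^sub>L s)" using s by (simp add: vn_sa_iff psd_op_square)
  then obtain R where R: "psd_op R" "R o\<^sub>L R = s o\<^sub>L s"
    and comm: "\<And>C. (s o\<^sub>L s) o\<^sub>L C = C o\<^sub>L (s o\<^sub>L s) \<Longrightarrow> R o\<^sub>L C = C o\<^sub>L R"
    using psd_sqrt_exists by blast
  have comm': "R o\<^sub>L C = C o\<^sub>L R" if C: "s o\<^sub>L C = C o\<^sub>L s" for C
  proof (rule comm)
    have "s (C x) = C (s x)" for x using C by (metis blinfun_apply_blinfun_compose)
    then show "(s o\<^sub>L s) o\<^sub>L C = C o\<^sub>L (s o\<^sub>L s)" by (intro blinfun_eqI) simp
  qed
  have s_lin: "s (c *\<^sub>C x) = c *\<^sub>C s x" for c x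
    using s M_bounded by (simp add: vn_sa_iff blinfun_scaleC_right)
  have bounded: "R \<in> bounded_ops"
    unfolding bounded_ops_def
  proof (intro CollectI allI)
    fix c x
    have J: "Blinfun ((*\<^sub>C) c) y = c *\<^sub>C y" for y :: 'h
      by (simp add: bounded_linear_Blinfun_apply bounded_linear_scaleC)
    have "R o\<^sub>L Blinfun ((*\<^sub>C) c) = Blinfun ((*\<^sub>C) c) o\<^sub>L R"
      by (rule comm', rule blinfun_eqI) (simp add: J s_lin)
    then show "R (c *\<^sub>C x) = c *\<^sub>C R x" by (metis J blinfun_apply_blinfun_compose)
  qed
  have "R \<in> commutant (commutant M)"
  proof -
    have "C o\<^sub>L R = R o\<^sub>L C" if "C \<in> commutant M" for C
      using that s by (intro comm'[symmetric]) (simp add: commutant_def vn_sa_iff)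
    then show ?thesis using bounded by (simp add: commutant_def)
  qed
  then have "R \<in> M" by (simp add: bicommutant)
  moreover have "abs_op s = R" using R bounded by (intro abs_op_eqI[OF s])
  ultimately show "abs_op s \<in> vn_pos M" and "abs_op s o\<^sub>L abs_op s = s o\<^sub>L s"
    and "abs_op s o\<^sub>L s = s o\<^sub>L abs_op s"
    using R comm'[of s] by (auto simp: vn_pos_iff)
qed

lemma abs_op_pos: "p \<in> vn_pos M \<Longrightarrow> abs_op p = p"
  using pos_sa M_bounded by (intro abs_op_eqI) (auto simp: vn_pos_iff)

definition pos_part :: "('h \<Rightarrow>\<^sub>L 'h) \<Rightarrow> ('h \<Rightarrow>\<^sub>L 'h)" where
  "pos_part s = (1/2) *\<^sub>R (abs_op s + s)"

definition neg_part :: "('h \<Rightarrow>\<^sub>L 'h) \<Rightarrow> ('h \<Rightarrow>\<^sub>L 'h)" where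
  "neg_part s = (1/2) *\<^sub>R (abs_op s - s)"

lemma parts_pos:
  assumes s: "s \<in> vn_sa M"
  shows "pos_part s \<in> vn_pos M" "neg_part s \<in> vn_pos M"
proof -
  note abs = abs_op_sa[OF s]
  have "\<bar>rip x (s x)\<bar> \<le> rip x (abs_op s x)" for x
    using s abs by (intro rip_le_abs) (auto simp: vn_sa_iff vn_pos_iff)
  then have le: "0 \<le> rip x (abs_op s x) + rip x (s x)" "0 \<le> rip x (abs_op s x) - rip x (s x)" for x
    by (smt (verit, best))+
  show "pos_part s \<in> vn_pos M" "neg_part s \<in> vn_pos M"
    using s abs(1) le
    by (auto simp: pos_part_def neg_part_def vn_pos_iff vn_sa_iff M_add M_diff M_scaleR psd_op_def
        sym_op_add sym_op_diff sym_op_scaleR blinfun.bilinear_simps rip_simps)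
qed

lemma parts_sum: "pos_part s + neg_part s = abs_op s"
  and parts_diff: "pos_part s - neg_part s = s"
  by (simp_all add: pos_part_def neg_part_def flip: scaleR_add_right scaleR_diff_right scaleR_2)

section \<open>The trace on self-adjoint trace class operators\<close>

lemma trace_add: "x \<in> vn_pos M \<Longrightarrow> y \<in> vn_pos M \<Longrightarrow> \<tau> (x + y) = \<tau> x + \<tau> y"
  using trace by (auto simp: trace_on_def)

abbreviation L1_core :: "('h \<Rightarrow>\<^sub>L 'h) set" where "L1_core \<equiv> trace_class M \<tau> \<inter> vn_sa M"

abbreviation L1_core_pos :: "('h \<Rightarrow>\<^sub>L 'h) set" where "L1_core_pos \<equiv> trace_class M \<tau> \<inter> vn_pos M"

text \<open>All of this is contained in \<open>is_L1\<close>; even the triangle inequality for the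
  trace norm comes with the linear isometry \<open>\<iota>\<close>.\<close>

lemma shows tc_zero: "0 \<in> trace_class M \<tau>"
    and tc_add: "x \<in> trace_class M \<tau> \<Longrightarrow> y \<in> trace_class M \<tau> \<Longrightarrow> x + y \<in> trace_class M \<tau>"
    and tc_scaleC: "x \<in> trace_class M \<tau> \<Longrightarrow> c *\<^sub>C x \<in> trace_class M \<tau>"
    and \<iota>_add: "x \<in> trace_class M \<tau> \<Longrightarrow> y \<in> trace_class M \<tau> \<Longrightarrow> \<iota> (x + y) = \<iota> x + \<iota> y"
    and \<iota>_scaleC: "x \<in> trace_class M \<tau> \<Longrightarrow> \<iota> (c *\<^sub>C x) = c *\<^sub>C \<iota> x"
    and \<iota>_norm: "x \<in> trace_class M \<tau> \<Longrightarrow> norm (\<iota> x) = enn2real (\<tau> (abs_op x))"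
  using L1 by (auto simp: is_L1_def is_completion_def)

lemma tc_scaleR: "x \<in> trace_class M \<tau> \<Longrightarrow> r *\<^sub>R x \<in> trace_class M \<tau>"
  and \<iota>_scaleR: "x \<in> trace_class M \<tau> \<Longrightarrow> \<iota> (r *\<^sub>R x) = r *\<^sub>R \<iota> x"
  by (simp_all add: scaleR_scaleC tc_scaleC \<iota>_scaleC)

lemma tc_diff: "x \<in> trace_class M \<tau> \<Longrightarrow> y \<in> trace_class M \<tau> \<Longrightarrow> x - y \<in> trace_class M \<tau>"
  and \<iota>_diff: "x \<in> trace_class M \<tau> \<Longrightarrow> y \<in> trace_class M \<tau> \<Longrightarrow> \<iota> (x - y) = \<iota> x - \<iota> y"
  using tc_add[OF _ tc_scaleR[of y "-1"], of x] \<iota>_add[OF _ tc_scaleR[of y "-1"], of x] \<iota>_scaleR[of y "-1"]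
  by simp_all

lemma core_pos_sub: "L1_core_pos \<subseteq> L1_core"
  using pos_sa by blast

lemma core_pos_iff: "p \<in> L1_core_pos \<longleftrightarrow> p \<in> vn_pos M \<and> \<tau> p < \<infinity>"
  by (auto simp: trace_class_def abs_op_pos vn_pos_iff)

lemma core_pos_add: "p \<in> L1_core_pos \<Longrightarrow> q \<in> L1_core_pos \<Longrightarrow> p + q \<in> L1_core_pos"
  by (simp add: tc_add vn_pos_add)

lemma core_pos_norm: "p \<in> L1_core_pos \<Longrightarrow> norm (\<iota> p) = enn2real (\<tau> p)"
  by (simp add: \<iota>_norm abs_op_pos)

lemma core_pos_norm_add:
  assumes "p \<in> L1_core_pos" "q \<in> L1_core_pos"
  shows "norm (\<iota> p + \<iota> q) = norm (\<iota> p) + norm (\<iota> q)"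
proof -
  have "norm (\<iota> p + \<iota> q) = enn2real (\<tau> (p + q))"
    using assms core_pos_norm[OF core_pos_add[OF assms]] by (simp add: \<iota>_add)
  also have "\<dots> = enn2real (\<tau> p) + enn2real (\<tau> q)"
    using assms[unfolded core_pos_iff] by (simp add: trace_add enn2real_plus)
  finally show ?thesis using assms by (simp add: core_pos_norm)
qed

text \<open>The modulus is the sum of the two parts and the trace is additive on it; this makes the
  Jordan decomposition exact for the norm.\<close>

lemma parts_core:
  assumes s: "s \<in> L1_core"
  shows "pos_part s \<in> L1_core_pos" "neg_part s \<in> L1_core_pos"
    and "\<iota> s = \<iota> (pos_part s) - \<iota> (neg_part s)"
    and "norm (\<iota> s) = norm (\<iota> (pos_part s)) + norm (\<iota> (neg_part s))"
proof -
  have sa: "s \<in> vn_sa M" and fin: "\<tau> (abs_op s) < \<infinity>" using s by (auto simp: trace_class_def)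
  note pos = parts_pos[OF sa]
  have sum: "\<tau> (abs_op s) = \<tau> (pos_part s) + \<tau> (neg_part s)"
    using trace_add[OF pos] by (simp add: parts_sum)
  show p: "pos_part s \<in> L1_core_pos" and n: "neg_part s \<in> L1_core_pos"
    using fin pos unfolding core_pos_iff sum by auto
  show "\<iota> s = \<iota> (pos_part s) - \<iota> (neg_part s)"
    using \<iota>_diff[of "pos_part s" "neg_part s"] p n by (simp add: parts_diff)
  show "norm (\<iota> s) = norm (\<iota> (pos_part s)) + norm (\<iota> (neg_part s))"
    using s p[unfolded core_pos_iff] n[unfolded core_pos_iff]
    by (simp add: \<iota>_norm sum enn2real_plus core_pos_norm[OF p] core_pos_norm[OF n])
qed

lemma trace_ext_sa_parts: "trace_ext_sa \<tau> s = enn2real (\<tau> (pos_part s)) - enn2real (\<tau> (neg_part s))"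
  by (simp add: trace_ext_sa_def pos_part_def neg_part_def)

text \<open>The value does not depend on the decomposition:
  \<open>pos_part (a - b) + b = neg_part (a - b) + a\<close>, and since all traces are finite this
  may be rearranged after applying \<open>\<tau>\<close>.\<close>

lemma trace_ext_sa_diff_pos:
  assumes a: "a \<in> L1_core_pos" and b: "b \<in> L1_core_pos"
  shows "trace_ext_sa \<tau> (a - b) = enn2real (\<tau> a) - enn2real (\<tau> b)"
proof -
  let ?s = "a - b"
  have s: "?s \<in> L1_core" using a b by (simp add: tc_diff vn_sa_diff pos_sa)
  note parts = parts_core(1,2)[OF s]
  have "pos_part ?s + b = neg_part ?s + a"
    using parts_diff[of ?s] by (simp add: algebra_simps)
  then have "\<tau> (pos_part ?s) + \<tau> b = \<tau> (neg_part ?s) + \<tau> a"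
    using parts a b trace_add by (metis IntD2)
  then have "enn2real (\<tau> (pos_part ?s)) + enn2real (\<tau> b) = enn2real (\<tau> (neg_part ?s)) + enn2real (\<tau> a)"
    using parts[unfolded core_pos_iff] a[unfolded core_pos_iff] b[unfolded core_pos_iff]
    by (metis enn2real_plus infinity_ennreal_def)
  then show ?thesis by (simp add: trace_ext_sa_parts)
qed

lemma trace_ext_sa_diff:
  assumes s: "s \<in> L1_core" and t: "t \<in> L1_core"
  shows "trace_ext_sa \<tau> (s - t) = trace_ext_sa \<tau> s - trace_ext_sa \<tau> t"
proof -
  note ps = parts_core(1,2)[OF s] and pt = parts_core(1,2)[OF t]
  have "s - t = (pos_part s + neg_part t) - (neg_part s + pos_part t)"
    using parts_diff[of s] parts_diff[of t] by (simp add: algebra_simps)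
  then have "trace_ext_sa \<tau> (s - t)
      = enn2real (\<tau> (pos_part s + neg_part t)) - enn2real (\<tau> (neg_part s + pos_part t))"
    using trace_ext_sa_diff_pos[OF core_pos_add[OF ps(1) pt(2)] core_pos_add[OF ps(2) pt(1)]] by simp
  then show ?thesis
    using ps[unfolded core_pos_iff] pt[unfolded core_pos_iff]
    by (simp add: trace_ext_sa_parts trace_add enn2real_plus)
qed

text \<open>With additivity this makes the trace Lipschitz for the norm of \<open>L_1\<close>, which
  lets it pass to limits.\<close>

lemma trace_ext_sa_bound: "s \<in> L1_core \<Longrightarrow> \<bar>trace_ext_sa \<tau> s\<bar> \<le> norm (\<iota> s)"
  using parts_core[of s] core_pos_norm[of "pos_part s"] core_pos_norm[of "neg_part s"]
  by (auto simp: trace_ext_sa_parts abs_le_iff intro: add_increasing add_increasing2)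

lemma zero_core_pos: "0 \<in> L1_core_pos"
proof -
  have "0 \<in> trace_class M \<tau>" by (rule tc_zero)
  then show ?thesis by (auto simp: vn_pos_iff trace_class_def psd_op_def sym_op_def)
qed

lemma trace_ext_core:
  assumes s: "s \<in> L1_core"
  shows "trace_ext \<tau> s = complex_of_real (trace_ext_sa \<tau> s)"
proof -
  have "trace_ext_sa \<tau> 0 = 0"
    using trace_ext_sa_diff_pos[OF zero_core_pos zero_core_pos] by simp
  moreover have "c *\<^sub>C (0 :: 'h \<Rightarrow>\<^sub>L 'h) = 0" for c
    by (metis mult_zero_right norm_eq_zero norm_scaleC norm_zero)
  moreover have "(1/2) *\<^sub>R (s + s) = s" by (simp flip: scaleR_2)
  ultimately show ?thesis
    using s by (simp add: trace_ext_def adj_sa complex_of_real_def)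
qed

section \<open>Pairing with the unit, and the self-adjoint part of the completion\<close>

text \<open>The description in \<open>L1_pairing\<close> demands one limit along every self-adjoint
  approximating sequence, whereas \<open>y\<close> is given as a limit of positive ones. On these
  the trace is the norm; the Lipschitz bound carries the limit over to all others.\<close>

lemma L1_pairing_one:
  assumes y: "y \<in> L1_pos M \<tau> \<iota>"
  shows "L1_pairing M \<tau> \<iota> y id_blinfun = complex_of_real (norm y)"
proof -
  obtain p where p: "\<And>n. p n \<in> L1_core_pos" and lim: "(\<lambda>n. \<iota> (p n)) \<longlonglongrightarrow> y"
  proof -
    obtain z where z: "\<And>n. z n \<in> \<iota> ` L1_core_pos" "z \<longlonglongrightarrow> y"
      using y by (auto simp: L1_pos_def closure_sequential)
    then have "\<forall>n. \<exists>q. q \<in> L1_core_pos \<and> z n = \<iota> q" by blast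
    then obtain q where q: "\<And>n. q n \<in> L1_core_pos" "\<And>n. z n = \<iota> (q n)" by metis
    then have "z = (\<lambda>n. \<iota> (q n))" by auto
    then show ?thesis using that[of q] q z by blast
  qed
  have pc: "p n \<in> L1_core" for n using p core_pos_sub by blast
  have tp: "trace_ext_sa \<tau> (p n) = norm (\<iota> (p n))" for n
    using trace_ext_sa_diff_pos[OF p zero_core_pos, of n]
      trace_ext_sa_diff_pos[OF zero_core_pos zero_core_pos] core_pos_norm[OF p, of n]
      core_pos_norm[OF zero_core_pos] \<iota>_scaleR[OF tc_zero, of 0] by simp
  have tlim: "(\<lambda>n. trace_ext_sa \<tau> (p n)) \<longlonglongrightarrow> norm y"
    unfolding tp using lim by (rule tendsto_norm)
  have conv: "(\<lambda>n. trace_ext \<tau> (s n o\<^sub>L id_blinfun)) \<longlonglongrightarrow> complex_of_real (norm y)"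
    if s: "\<forall>n. s n \<in> L1_core" and slim: "(\<lambda>n. \<iota> (s n)) \<longlonglongrightarrow> y" for s
  proof -
    have sc: "s n \<in> L1_core" for n using s by blast
    have "(\<lambda>n. \<iota> (s n) - \<iota> (p n)) \<longlonglongrightarrow> 0" using tendsto_diff[OF slim lim] by simp
    then have null: "(\<lambda>n. norm (\<iota> (s n) - \<iota> (p n))) \<longlonglongrightarrow> 0" by (rule tendsto_norm_zero)
    have "norm (trace_ext_sa \<tau> (s n) - trace_ext_sa \<tau> (p n)) \<le> norm (\<iota> (s n) - \<iota> (p n))" for n
      using trace_ext_sa_bound[of "s n - p n"] sc[of n] pc[of n]
      by (simp add: trace_ext_sa_diff[OF sc pc] \<iota>_diff tc_diff vn_sa_diff)
    then have "(\<lambda>n. trace_ext_sa \<tau> (s n) - trace_ext_sa \<tau> (p n)) \<longlonglongrightarrow> 0"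
      by (intro Lim_null_comparison[OF _ null] always_eventually allI)
    from tendsto_add[OF this tlim] have "(\<lambda>n. trace_ext_sa \<tau> (s n)) \<longlonglongrightarrow> norm y" by simp
    then have "(\<lambda>n. complex_of_real (trace_ext_sa \<tau> (s n))) \<longlonglongrightarrow> complex_of_real (norm y)"
      by (rule tendsto_of_real)
    moreover have "s n o\<^sub>L id_blinfun = s n" for n by (rule blinfun_eqI) simp
    ultimately show ?thesis by (simp add: trace_ext_core[OF sc])
  qed
  show ?thesis
    unfolding L1_pairing_def
  proof (rule the_equality)
    show "\<forall>s. (\<forall>n. s n \<in> L1_core) \<and> (\<lambda>n. \<iota> (s n)) \<longlonglongrightarrow> y
        \<longrightarrow> (\<lambda>n. trace_ext \<tau> (s n o\<^sub>L id_blinfun)) \<longlonglongrightarrow> complex_of_real (norm y)"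
      using conv by blast
    \<comment> \<open>The positive sequence \<open>p\<close> is an instance of the condition, which
      is therefore not vacuous and determines \<open>c\<close>.\<close>
    fix c assume "\<forall>s. (\<forall>n. s n \<in> L1_core) \<and> (\<lambda>n. \<iota> (s n)) \<longlonglongrightarrow> y
        \<longrightarrow> (\<lambda>n. trace_ext \<tau> (s n o\<^sub>L id_blinfun)) \<longlonglongrightarrow> c"
    then have "(\<lambda>n. trace_ext \<tau> (p n o\<^sub>L id_blinfun)) \<longlonglongrightarrow> c" using pc lim by blast
    then show "c = complex_of_real (norm y)"
      using conv[of p] pc lim LIMSEQ_unique by blast
  qed
qed

lemma symmetrize_core:
  assumes x: "x \<in> trace_class M \<tau>" "adj x \<in> trace_class M \<tau>"
  shows "(1/2) *\<^sub>R (x + adj x) \<in> L1_core"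
proof -
  have xM: "x \<in> M" using x by (simp add: trace_class_def)
  then obtain B where B: "B \<in> M" "is_adjoint x B" using M_adjoint by blast
  have "rip ((x + B) u) v = rip u ((x + B) v)" for u v
    using is_adjoint_rip[OF B(2), of u v] is_adjoint_rip[OF B(2), of v u]
    by (simp add: blinfun.add_left rip_simps rip_commute)
  then have "sym_op (x + B)" unfolding sym_op_def by blast
  then have "(1/2) *\<^sub>R (x + B) \<in> vn_sa M"
    using xM B(1) by (simp only: vn_sa_iff M_add M_scaleR sym_op_scaleR)
  then show ?thesis using x adj_eq[OF B(2)] by (simp add: tc_add tc_scaleR)
qed

text \<open>If \<open>(y, y)\<close> is approximated by \<open>x\<close> paired with its adjoint,
  the average of both entries is a self-adjoint approximation of \<open>y\<close>. Conversely the
  diagonal map is continuous and sends the core into the graph.\<close>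

lemma L1_sa_eq: "L1_sa M \<tau> \<iota> = closure (\<iota> ` L1_core)"
proof (intro equalityI subsetI)
  fix y assume "y \<in> L1_sa M \<tau> \<iota>"
  then have y: "(y, y) \<in> closure {(\<iota> x, \<iota> (adj x)) | x. x \<in> trace_class M \<tau> \<and> adj x \<in> trace_class M \<tau>}"
    by (simp add: L1_sa_def L1_adj_def)
  show "y \<in> closure (\<iota> ` L1_core)"
    unfolding closure_approachable
  proof (intro allI impI)
    fix e :: real assume e: "0 < e"
    then obtain x where x: "x \<in> trace_class M \<tau>" "adj x \<in> trace_class M \<tau>"
      and d: "dist (\<iota> x, \<iota> (adj x)) (y, y) < e"
      using y unfolding closure_approachable by blast
    have d1: "norm (\<iota> x - y) < e"
      using d dist_fst_le[of "(\<iota> x, \<iota> (adj x))" "(y, y)"] by (simp add: dist_norm)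
    have d2: "norm (\<iota> (adj x) - y) < e"
      using d dist_snd_le[of "(\<iota> x, \<iota> (adj x))" "(y, y)"] by (simp add: dist_norm)
    let ?s = "(1/2) *\<^sub>R (x + adj x)"
    have "\<iota> ?s - y = (1/2) *\<^sub>R (\<iota> x + \<iota> (adj x)) - (1/2) *\<^sub>R (y + y)"
      using x by (simp add: \<iota>_scaleR \<iota>_add tc_add flip: scaleR_2)
    also have "\<dots> = (1/2) *\<^sub>R ((\<iota> x - y) + (\<iota> (adj x) - y))"
      by (simp add: scaleR_add_right scaleR_diff_right)
    finally have "norm (\<iota> ?s - y) \<le> (1/2) * (norm (\<iota> x - y) + norm (\<iota> (adj x) - y))"
      by (simp add: norm_triangle_ineq)
    then have "dist (\<iota> ?s) y < e" using d1 d2 by (simp add: dist_norm)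
    then show "\<exists>z\<in>\<iota> ` L1_core. dist z y < e" using symmetrize_core[OF x] by blast
  qed
next
  fix y assume "y \<in> closure (\<iota> ` L1_core)"
  then have y: "(y, y) \<in> (\<lambda>z. (z, z)) ` closure (\<iota> ` L1_core)" by blast
  also have "\<dots> \<subseteq> closure ((\<lambda>z. (z, z)) ` \<iota> ` L1_core)"
    by (intro image_closure_subset continuous_intros closed_closure closure_subset)
  also have "\<dots> \<subseteq> closure {(\<iota> x, \<iota> (adj x)) | x. x \<in> trace_class M \<tau> \<and> adj x \<in> trace_class M \<tau>}"
    by (intro closure_mono) (auto simp: adj_sa intro!: exI)
  finally show "y \<in> L1_sa M \<tau> \<iota>" by (simp add: L1_sa_def L1_adj_def)
qed

end

section \<open>The completion as a cone with additive norm\<close>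

lemma closure_binary_closed:
  fixes D :: "'a :: real_normed_vector set"
  assumes "\<And>x y. x \<in> D \<Longrightarrow> y \<in> D \<Longrightarrow> x + y \<in> D" "x \<in> closure D" "y \<in> closure D"
  shows "x + y \<in> closure D"
proof -
  obtain f g where "\<And>n. f n \<in> D" "f \<longlonglongrightarrow> x" "\<And>n. g n \<in> D" "g \<longlonglongrightarrow> y"
    using assms(2,3) by (auto simp: closure_sequential)
  then have "\<And>n. f n + g n \<in> D" "(\<lambda>n. f n + g n) \<longlonglongrightarrow> x + y"
    using assms(1) by (auto intro: tendsto_add)
  then show ?thesis unfolding closure_sequential by (intro exI conjI allI)
qed

lemma closure_scaleR_closed:
  fixes D :: "'a :: real_normed_vector set"
  assumes "\<And>x. x \<in> D \<Longrightarrow> r *\<^sub>R x \<in> D" "x \<in> closure D"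
  shows "r *\<^sub>R x \<in> closure D"
proof -
  obtain f where "\<And>n. f n \<in> D" "f \<longlonglongrightarrow> x"
    using assms(2) by (auto simp: closure_sequential)
  then have "\<And>n. r *\<^sub>R f n \<in> D" "(\<lambda>n. r *\<^sub>R f n) \<longlonglongrightarrow> r *\<^sub>R x"
    using assms(1) by (auto intro: tendsto_scaleR)
  then show ?thesis unfolding closure_sequential by (intro exI conjI allI)
qed

context traced_vn_algebra
begin

lemma L1_pos_norm_add:
  assumes "y \<in> L1_pos M \<tau> \<iota>" "z \<in> L1_pos M \<tau> \<iota>"
  shows "norm (y + z) = norm y + norm z"
proof -
  obtain f where f: "\<forall>n. f n \<in> \<iota> ` L1_core_pos" "f \<longlonglongrightarrow> y"
    using assms(1) unfolding L1_pos_def closure_sequential by (elim exE conjE)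
  obtain g where g: "\<forall>n. g n \<in> \<iota> ` L1_core_pos" "g \<longlonglongrightarrow> z"
    using assms(2) unfolding L1_pos_def closure_sequential by (elim exE conjE)
  have "norm (f n + g n) = norm (f n) + norm (g n)" for n
  proof -
    obtain p where p: "f n = \<iota> p" "p \<in> L1_core_pos" using f(1) by blast
    obtain q where q: "g n = \<iota> q" "q \<in> L1_core_pos" using g(1) by blast
    show ?thesis using core_pos_norm_add[OF p(2) q(2)] by (simp only: p(1) q(1))
  qed
  moreover have "(\<lambda>n. norm (f n + g n)) \<longlonglongrightarrow> norm (y + z)"
    using f(2) g(2) by (intro tendsto_intros)
  moreover have "(\<lambda>n. norm (f n) + norm (g n)) \<longlonglongrightarrow> norm y + norm z"
    using f(2) g(2) by (intro tendsto_intros)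
  ultimately show ?thesis using LIMSEQ_unique by simp
qed

sublocale cone_space "L1_sa M \<tau> \<iota>" "L1_pos M \<tau> \<iota>"
proof
  have sum: "u + v \<in> \<iota> ` L1_core" if uv: "u \<in> \<iota> ` L1_core" "v \<in> \<iota> ` L1_core" for u v
  proof -
    obtain a b where ab: "a \<in> L1_core" "b \<in> L1_core" "u = \<iota> a" "v = \<iota> b" using uv by blast
    then have "u + v = \<iota> (a + b)" "a + b \<in> L1_core" by (simp_all add: \<iota>_add tc_add vn_sa_add)
    then show ?thesis by (rule image_eqI)
  qed
  have scale: "r *\<^sub>R u \<in> \<iota> ` L1_core" if u: "u \<in> \<iota> ` L1_core" for r u
  proof -
    obtain a where a: "a \<in> L1_core" "u = \<iota> a" using u by blast
    then have "r *\<^sub>R u = \<iota> (r *\<^sub>R a)" "r *\<^sub>R a \<in> L1_core" by (simp_all add: \<iota>_scaleR tc_scaleR vn_sa_scaleR)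
    then show ?thesis by (rule image_eqI)
  qed
  have \<iota>_zero: "\<iota> 0 = 0" using \<iota>_scaleR[OF tc_zero, of 0] by simp
  have zero: "0 \<in> \<iota> ` L1_core_pos" 
    by (rule image_eqI[where x = 0, OF _ zero_core_pos]) (simp add: \<iota>_zero)
  show zero_pos: "0 \<in> L1_pos M \<tau> \<iota>"
    unfolding L1_pos_def using zero by (rule subsetD[OF closure_subset])
  show sub: "L1_pos M \<tau> \<iota> \<subseteq> L1_sa M \<tau> \<iota>"
    unfolding L1_pos_def L1_sa_eq by (intro closure_mono image_mono core_pos_sub)
  show "subspace (L1_sa M \<tau> \<iota>)"
  proof (rule subspaceI)
    show "0 \<in> L1_sa M \<tau> \<iota>" using zero_pos by (rule subsetD[OF sub])
    show "u + v \<in> L1_sa M \<tau> \<iota>" if "u \<in> L1_sa M \<tau> \<iota>" "v \<in> L1_sa M \<tau> \<iota>" for u v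
      using that unfolding L1_sa_eq by (rule closure_binary_closed[rotated]) (rule sum)
    show "r *\<^sub>R u \<in> L1_sa M \<tau> \<iota>" if "u \<in> L1_sa M \<tau> \<iota>" for r u
      using that unfolding L1_sa_eq by (rule closure_scaleR_closed[rotated]) (rule scale)
  qed
  have pos_sum: "u + v \<in> \<iota> ` L1_core_pos" if uv: "u \<in> \<iota> ` L1_core_pos" "v \<in> \<iota> ` L1_core_pos" for u v
  proof -
    obtain a b where ab: "a \<in> L1_core_pos" "b \<in> L1_core_pos" "u = \<iota> a" "v = \<iota> b" using uv by blast
    then have "u + v = \<iota> (a + b)" "a + b \<in> L1_core_pos" by (simp_all add: \<iota>_add tc_add vn_pos_add)
    then show ?thesis by (rule image_eqI)
  qed
  have pos_scale: "r *\<^sub>R u \<in> \<iota> ` L1_core_pos" if r: "0 \<le> r" and u: "u \<in> \<iota> ` L1_core_pos" for r u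
  proof -
    obtain a where a: "a \<in> L1_core_pos" "u = \<iota> a" using u by blast
    then have "r *\<^sub>R u = \<iota> (r *\<^sub>R a)" "r *\<^sub>R a \<in> L1_core_pos"
      using r by (simp_all add: \<iota>_scaleR tc_scaleR vn_pos_scaleR)
    then show ?thesis by (rule image_eqI)
  qed
  show "p + q \<in> L1_pos M \<tau> \<iota>" if "p \<in> L1_pos M \<tau> \<iota>" "q \<in> L1_pos M \<tau> \<iota>" for p q
    using that unfolding L1_pos_def by (rule closure_binary_closed[rotated]) (rule pos_sum)
  show "r *\<^sub>R p \<in> L1_pos M \<tau> \<iota>" if "0 \<le> r" "p \<in> L1_pos M \<tau> \<iota>" for r p
    using that(2) unfolding L1_pos_def by (rule closure_scaleR_closed[rotated]) (rule pos_scale[OF that(1)])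
  show "norm (p + q) = norm p + norm q" if "p \<in> L1_pos M \<tau> \<iota>" "q \<in> L1_pos M \<tau> \<iota>" for p q
    using that by (rule L1_pos_norm_add)
  \<comment> \<open>The Jordan decomposition is that of a nearby element \<open>s\<close> of the
    dense core, hence an approximate decomposition of \<open>x\<close>, as the locale asks
    for.\<close>
  fix x and e :: real assume x: "x \<in> L1_sa M \<tau> \<iota>" and e: "0 < e"
  obtain s where s: "s \<in> L1_core" and d: "norm (\<iota> s - x) < e"
    using x e unfolding L1_sa_eq closure_approachable dist_norm by blast
  have mem: "\<iota> (pos_part s) \<in> L1_pos M \<tau> \<iota>" "\<iota> (neg_part s) \<in> L1_pos M \<tau> \<iota>"
    unfolding L1_pos_def using parts_core(1,2)[OF s]
    by (auto simp del: IntI Int_iff intro!: subsetD[OF closure_subset] imageI)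
  have "norm (x - (\<iota> (pos_part s) - \<iota> (neg_part s))) \<le> e"
    using d by (simp add: parts_core(3)[OF s, symmetric] norm_minus_commute)
  moreover have "norm (\<iota> (pos_part s)) + norm (\<iota> (neg_part s)) \<le> norm x + e"
    using d norm_triangle_ineq2[of "\<iota> s" x] by (simp add: parts_core(4)[OF s, symmetric])
  ultimately show "\<exists>p\<in>L1_pos M \<tau> \<iota>. \<exists>q\<in>L1_pos M \<tau> \<iota>. norm (x - (p - q)) \<le> e \<and> norm p + norm q \<le> norm x + e"
    using mem by blast
qed

text \<open>By duality \<open>p\<close> and \<open>T p\<close> have the same pairing with the unit,
  and on the positive cone this pairing is the norm.\<close>

lemma unital_markov:
  assumes T: "positive_contraction M \<tau> \<iota> T" and unit: "unital M \<tau> \<iota> T"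
  shows "markov T"
proof -
  have "norm (T p) = norm p" if p: "p \<in> L1_pos M \<tau> \<iota>" for p
  proof -
    have Tp: "T p \<in> L1_pos M \<tau> \<iota>" using T p by (simp add: positive_contraction_def positive_on_def)
    have "L1_pairing M \<tau> \<iota> (T p) id_blinfun = L1_pairing M \<tau> \<iota> p id_blinfun"
      using unit XI[OF p] by (simp add: unital_def is_conjugate_def)
    then show ?thesis by (simp add: L1_pairing_one[OF p] L1_pairing_one[OF Tp])
  qed
  then show ?thesis using T by (simp add: markov_def positive_contraction_def)
qed

lemma positive_contraction_pos_operator: "positive_contraction M \<tau> \<iota> S \<Longrightarrow> pos_operator S"
  by (rule pos_operatorI[of _ 1]) (auto simp: positive_contraction_def positive_on_def contraction_on_def)

end

theorem theorem4p1:
  fixes M :: "('h :: complex_hilbert \<Rightarrow>\<^sub>L 'h) set"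
    and \<tau> :: "('h \<Rightarrow>\<^sub>L 'h) \<Rightarrow> ennreal"
    and \<iota> :: "('h \<Rightarrow>\<^sub>L 'h) \<Rightarrow> 'l :: complex_banach"
    and d :: nat
    and Z S :: "'l \<Rightarrow> 'l"
    and T :: "nat \<Rightarrow> 'l \<Rightarrow> 'l"
    and m k :: "nat \<Rightarrow> nat"
  assumes "von_neumann_algebra M"
    and "trace_on M \<tau>" and "faithful_trace M \<tau>" and "normal_trace M \<tau>" and "semifinite_trace M \<tau>"
    and "is_L1 M \<tau> \<iota>"
    and "d \<ge> 1"
    and "positive_contraction M \<tau> \<iota> Z" and "unital M \<tau> \<iota> Z"
    and "\<And>i. i \<in> {1..d} \<Longrightarrow> positive_contraction M \<tau> \<iota> (T i)"
    and "\<And>i. i \<in> {1..d} \<Longrightarrow> unital M \<tau> \<iota> (T i)"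
    and "\<And>i. i \<in> {1..d} \<Longrightarrow> commute_on (L1_sa M \<tau> \<iota>) Z (T i)"
    and "\<And>i j. i \<in> {1..d} \<Longrightarrow> j \<in> {1..d} \<Longrightarrow> commute_on (L1_sa M \<tau> \<iota>) (T i) (T j)"
    and "positive_contraction M \<tau> \<iota> S"
    and "commute_on (L1_sa M \<tau> \<iota>) S Z"
    and "le_on (L1_pos M \<tau> \<iota>) (\<lambda>x. Z (S x)) (\<lambda>x. Z (multi_pow d T (\<lambda>i. m i + k i) x))"
    and "le_on (L1_pos M \<tau> \<iota>) (\<lambda>x. Z (S x)) (\<lambda>x. Z (multi_pow d T m x))"
    and "opnorm_on (L1_sa M \<tau> \<iota>) (\<lambda>x. Z (multi_pow d T (\<lambda>i. m i + k i) x - S x)) < 1"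
    and "opnorm_on (L1_sa M \<tau> \<iota>) (\<lambda>x. Z (multi_pow d T m x - S x)) < 1"
  shows "\<forall>\<epsilon>>0. \<exists>N\<ge>1. \<exists>n0 :: nat \<Rightarrow> nat. \<forall>n :: nat \<Rightarrow> nat. (\<forall>i\<in>{1..d}. n0 i \<le> n i) \<longrightarrow>
    opnorm_on (L1_sa M \<tau> \<iota>) (\<lambda>x. (Z ^^ N) (multi_pow d T (\<lambda>i. n i + k i) x - multi_pow d T n x)) < ennreal \<epsilon>"
proof (intro allI impI)
  interpret traced_vn_algebra M \<tau> \<iota>
    using assms(1,2,6) by unfold_locales
  interpret commuting_markov_family "L1_sa M \<tau> \<iota>" "L1_pos M \<tau> \<iota>" d T
    using assms(10,11,13) by unfold_locales (simp_all add: unital_markov)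
  fix \<epsilon> :: real assume "0 < \<epsilon>"
  then show "\<exists>N\<ge>1. \<exists>n0 :: nat \<Rightarrow> nat. \<forall>n :: nat \<Rightarrow> nat. (\<forall>i\<in>{1..d}. n0 i \<le> n i) \<longrightarrow>
    opnorm_on (L1_sa M \<tau> \<iota>) (\<lambda>x. (Z ^^ N) (multi_pow d T (\<lambda>i. n i + k i) x - multi_pow d T n x)) < ennreal \<epsilon>"
    using assms(12,16-19) unital_markov[OF assms(8,9)] positive_contraction_pos_operator[OF assms(14)]
    by (intro zero_two_law_multi[where m = m and S = S])
qed

end
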